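(* Let $n\ge 2$, $1\le d\le n-1$, and let $w$ be a weight such that $c_w^2\le W_k\le C_w^2$ for all $k\in\mathbb{Z}^n$, for some uniform constants $c_w,C_w>0$. Suppose that $\alpha>0$ and that $r,s\in\mathbb{R}$ satisfy $s\ge r$. Let $g\in L_r^{2,2}(X_{d,n};w)$. Then the unique minimizer, among all $f\in\mathcal{T}'$, of the Tikhonov functional $$\|R_df-g\|_{L_r^{2,2}(X_{d,n};w)}^2+\alpha\|f\|_{H^s(\mathbb{T}^n)}^2$$ is $f=P_{w,s-r}^\alpha R_d^*g$, and it belongs to $H^{2s-r}(\mathbb{T}^n)$.
   Context: Let $\mathbb{T}^n=\mathbb{R}^n/\mathbb{Z}^n$, $\mathcal{T}=C^\infty(\mathbb{T}^n)$, and let $\mathcal{T}'$ be its dual, the space of periodic distributions, with duality pairing $(\cdot,\cdot)$ (so $(f,g)=\int_{\mathbb{T}^n}fg$ for functions). Fourier coefficients are $\hat f(k)=(f,e^{-2\pi i k\cdot x})$, $k\in\mathbb{Z}^n$. $\mathbf{Gr}(d,n)$ is the set of all $d$-dimensional linear subspaces of $\mathbb{Q}^n$; $k\perp A$ means $k\cdot v=0$ for all $v\in A$. Radon transform: for $f\in\mathcal{T}$ and linearly independent $v_1,\dots,v_d\in\mathbb{Z}^n$, with $A=\{v_1,\dots,v_d\}$, $R_df(x,A)=\int_{[0,1]^d}f(x+t_1v_1+\cdots+t_dv_d)\,dt_1\cdots dt_d$. For $f\in\mathcal{T}'$, $R_df(\cdot,A)\in\mathcal{T}'$ is defined by $(R_df(\cdot,A),g)=(f,R_dg(\cdot,A))$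 for all $g\in\mathcal{T}$. This depends only on the subspace of $\mathbb{Q}^n$ spanned by $A$, so $R_df(\cdot,A)$ is regarded as defined for $A\in\mathbf{Gr}(d,n)$. For $\omega:\mathbb{Z}^n\to\mathbb{R}$, $F_\omega$ is the Fourier multiplier $\widehat{F_\omega f}(k)=\omega(k)\hat f(k)$. Write $\langle k\rangle=(1+|k|^2)^{1/2}$. For $s\in\mathbb{R}$, $H^s(\mathbb{T}^n)$ is the set of $f\in\mathcal{T}'$ with $\|f\|_{H^s}^2=\sum_k\langle k\rangle^{2s}|\hat f(k)|^2<\infty$ (norms are $+\infty$ outside the space). Weights: a weight is a function $w:\mathbb{Z}^n\times\mathbf{Gr}(d,n)\to(0,\infty)$ such that for each fixed $A$ there exist $C,N>0$ (possibly depending on $A$) with $w(k,A)\ge C\langle k\rangle^{-N}$ for all $k\in\mathbb{Z}^n$. Set $\Omega_k=\{A\in\mathbf{Gr}(d,n):k\perp A\}$ and $W_k=\sum_{A\in\Omega_k}w(k,A)^2$. Data space: $X_{d,n}=\mathbb{T}^n\times\mathbf{Gr}(d,n)$, and for $r\in\mathbb{R}$, $L_r^{2,2}(X_{d,n};w)$ is the Hilbert space of families $g=\{g(\cdot,A)\}_{A\in\mathbf{Gr}(d,n)}$ with $g(\cdot,A)\in\mathcal{T}'$ and $\|g\|^2=\sum_{A}\|F_{w(\cdot,A)}g(\cdot,A)\|_{H^r(\mathbb{T}^n)}^2<\infty$ (the norm is $+\infty$ otherwise), with the corresponding inner product. $R_d^*$ is the adjoint of $R_d:H^r(\mathbb{T}^n)\to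 L_r^{2,2}(X_{d,n};w)$, given by $\widehat{R_d^*g}(k)=\sum_{A\in\Omega_k}w(k,A)^2\hat g(k,A)$, where $\hat g(k,A)$ is the $k$-th Fourier coefficient of $g(\cdot,A)$. For $z\in\mathbb{R}$ and $\alpha>0$, $P_{w,z}^\alpha:\mathcal{T}'\to\mathcal{T}'$ is the Fourier multiplier with symbol $p_{w,z}^\alpha(k)=\dfrac{1}{W_k+\alpha\langle k\rangle^{2z}}$. *)

theory Defs
  imports "HOL-Analysis.Analysis"
begin

section \<open>Lattice vectors and rational subspaces\<close>

definition lat :: "int ^ 'n \<Rightarrow> 'a::ring_1 ^ 'n" where
  "lat k = (\<chi> i. of_int (k $ i))"

definition bracket :: "int ^ 'n \<Rightarrow> real" where
  "bracket k = sqrt (1 + (norm (lat k :: real ^ 'n))\<^sup>2)"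

definition Gr :: "nat \<Rightarrow> (rat ^ 'n) set set" where
  "Gr d = {A. vec.subspace A \<and> vec.dim A = d}"

definition perp :: "int ^ 'n \<Rightarrow> (rat ^ 'n) set \<Rightarrow> bool" where
  "perp k A \<longleftrightarrow> (\<forall>v\<in>A. (\<Sum>i\<in>UNIV. of_int (k $ i) * v $ i) = 0)"

section \<open>Smooth functions on the torus\<close>

text \<open>Functions on the torus are represented by their \<open>\<int>\<^sup>n\<close>-periodic lifts to \<open>\<real>\<^sup>n\<close>.\<close>

definition partial :: "'n \<Rightarrow> (real ^ 'n \<Rightarrow> complex) \<Rightarrow> real ^ 'n \<Rightarrow> complex" where
  "partial i f x = frechet_derivative f (at x) (axis i 1)"

text \<open>A multi-index is a list of coordinate directions.\<close>

definition partials :: "'n list \<Rightarrow> (real ^ 'n \<Rightarrow> complex) \<Rightarrow> real ^ 'n \<Rightarrow> complex" where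
  "partials is f = foldr partial is f"

definition test_funs :: "(real ^ 'n \<Rightarrow> complex) set" where
  "test_funs = {f. (\<forall>x k. f (x + lat k) = f x) \<and> (\<forall>is x. partials is f differentiable (at x))}"

definition Cm_norm :: "nat \<Rightarrow> (real ^ 'n \<Rightarrow> complex) \<Rightarrow> real" where
  "Cm_norm m f = (\<Sum>is | length is \<le> m. SUP x. cmod (partials is f x))"

section \<open>Periodic distributions\<close>

text \<open>Distributions are the linear functionals on the test functions that are continuous for the
  Frechet topology generated by the norms \<^const>\<open>Cm_norm\<close>.  They are \<^const>\<open>extensional\<close>, so that
  equality of functionals is equality of distributions.\<close>

definition distributions :: "((real ^ 'n \<Rightarrow> complex) \<Rightarrow> complex) set" where
  "distributions = {u \<in> extensional test_funs.
     (\<forall>\<phi>\<in>test_funs. \<forall>\<psi>\<in>test_funs. u (\<lambda>x. \<phi> x + \<psi> x) = u \<phi> + u \<psi>) \<and>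
     (\<forall>\<phi>\<in>test_funs. \<forall>c. u (\<lambda>x. c * \<phi> x) = c * u \<phi>) \<and>
     (\<exists>m C. \<forall>\<phi>\<in>test_funs. cmod (u \<phi>) \<le> C * Cm_norm m \<phi>)}"

definition minus_distr ::
  "((real ^ 'n \<Rightarrow> complex) \<Rightarrow> complex) \<Rightarrow> ((real ^ 'n \<Rightarrow> complex) \<Rightarrow> complex) \<Rightarrow>
   (real ^ 'n \<Rightarrow> complex) \<Rightarrow> complex" where
  "minus_distr u v = (\<lambda>\<phi>\<in>test_funs. u \<phi> - v \<phi>)"

definition fcoeff :: "((real ^ 'n \<Rightarrow> complex) \<Rightarrow> complex) \<Rightarrow> int ^ 'n \<Rightarrow> complex" where
  "fcoeff u k = u (\<lambda>x. exp (- 2 * complex_of_real pi * \<i> * complex_of_real (lat k \<bullet> x)))"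

text \<open>The multiplier \<open>F\<^sub>\<omega> u\<close> is a distribution only if the product of \<open>\<omega>\<close> with the
  Fourier coefficients of \<open>u\<close> is the coefficient sequence of a distribution.
  This is tracked by \<open>has_fmult\<close>; distributions are determined by their Fourier coefficients, so
  the description in \<open>fmult\<close> is then unique.\<close>

definition has_fmult :: "(int ^ 'n \<Rightarrow> real) \<Rightarrow> ((real ^ 'n \<Rightarrow> complex) \<Rightarrow> complex) \<Rightarrow> bool" where
  "has_fmult \<omega> u \<longleftrightarrow> (\<exists>v\<in>distributions. \<forall>k. fcoeff v k = complex_of_real (\<omega> k) * fcoeff u k)"

definition fmult ::
  "(int ^ 'n \<Rightarrow> real) \<Rightarrow> ((real ^ 'n \<Rightarrow> complex) \<Rightarrow> complex) \<Rightarrow> (real ^ 'n \<Rightarrow> complex) \<Rightarrow> complex" where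
  "fmult \<omega> u =
    (THE v. v \<in> distributions \<and> (\<forall>k. fcoeff v k = complex_of_real (\<omega> k) * fcoeff u k))"

section \<open>Sobolev spaces\<close>

definition sobolev_normsq :: "real \<Rightarrow> ((real ^ 'n \<Rightarrow> complex) \<Rightarrow> complex) \<Rightarrow> ennreal" where
  "sobolev_normsq s u =
    (\<Sum>\<^sub>\<infinity>k. ennreal (bracket k powr (2 * s) * (cmod (fcoeff u k))\<^sup>2))"

definition sobolev :: "real \<Rightarrow> ((real ^ 'n \<Rightarrow> complex) \<Rightarrow> complex) set" where
  "sobolev s = {u \<in> distributions. sobolev_normsq s u < \<infinity>}"

definition sobolev_inner ::
  "real \<Rightarrow> ((real ^ 'n \<Rightarrow> complex) \<Rightarrow> complex) \<Rightarrow> ((real ^ 'n \<Rightarrow> complex) \<Rightarrow> complex) \<Rightarrow> complex" where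
  "sobolev_inner s u v =
    (\<Sum>\<^sub>\<infinity>k. complex_of_real (bracket k powr (2 * s)) * fcoeff u k * cnj (fcoeff v k))"

section \<open>The Radon transform\<close>

text \<open>The direction vectors are given as a set \<open>B\<close>; the cube \<open>[0,1]\<^sup>d\<close> appears as
  \<open>[0,1]\<^sup>B\<close>.\<close>

definition radon_fun ::
  "(int ^ 'n) set \<Rightarrow> (real ^ 'n \<Rightarrow> complex) \<Rightarrow> real ^ 'n \<Rightarrow> complex" where
  "radon_fun B f x =
    (LINT t:(\<Pi>\<^sub>E v\<in>B. {0..1})|(\<Pi>\<^sub>M v\<in>B. lborel). f (x + (\<Sum>v\<in>B. t v *\<^sub>R lat v)))"

text \<open>Integer vectors that form a basis of \<open>A\<close>; the Radon transform does not depend on the choice.\<close>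

definition int_basis :: "(rat ^ 'n) set \<Rightarrow> (int ^ 'n) set" where
  "int_basis A = (SOME B. finite B \<and>
     vec.independent (lat ` B :: (rat ^ 'n) set) \<and> vec.span (lat ` B) = A)"

definition radon ::
  "((real ^ 'n \<Rightarrow> complex) \<Rightarrow> complex) \<Rightarrow> (rat ^ 'n) set \<Rightarrow> (real ^ 'n \<Rightarrow> complex) \<Rightarrow> complex" where
  "radon u A = (\<lambda>\<phi>\<in>test_funs. u (radon_fun (int_basis A) \<phi>))"

section \<open>Weights and the data space\<close>

definition weight :: "nat \<Rightarrow> (int ^ 'n \<Rightarrow> (rat ^ 'n) set \<Rightarrow> real) \<Rightarrow> bool" where
  "weight d w \<longleftrightarrow>
    (\<forall>A\<in>Gr d. (\<forall>k. w k A > 0) \<and> (\<exists>C>0. \<exists>N>0. \<forall>k. w k A \<ge> C * bracket k powr (- N)))"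

definition Omega :: "nat \<Rightarrow> int ^ 'n \<Rightarrow> (rat ^ 'n) set set" where
  "Omega d k = {A \<in> Gr d. perp k A}"

definition W :: "nat \<Rightarrow> (int ^ 'n \<Rightarrow> (rat ^ 'n) set \<Rightarrow> real) \<Rightarrow> int ^ 'n \<Rightarrow> ennreal" where
  "W d w k = (\<Sum>\<^sub>\<infinity>A\<in>Omega d k. ennreal ((w k A)\<^sup>2))"

text \<open>A weight need not be bounded above, so \<open>F\<^bsub>w(\<cdot>,A)\<^esub> g(\<cdot>,A)\<close> may fail to be a distribution;
  its norm is then infinite.\<close>

definition data_normsq ::
  "nat \<Rightarrow> real \<Rightarrow> (int ^ 'n \<Rightarrow> (rat ^ 'n) set \<Rightarrow> real) \<Rightarrow>
   ((rat ^ 'n) set \<Rightarrow> (real ^ 'n \<Rightarrow> complex) \<Rightarrow> complex) \<Rightarrow> ennreal" where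
  "data_normsq d r w g = (\<Sum>\<^sub>\<infinity>A\<in>Gr d.
     if has_fmult (\<lambda>k. w k A) (g A) then sobolev_normsq r (fmult (\<lambda>k. w k A) (g A)) else \<infinity>)"

definition data_space ::
  "nat \<Rightarrow> real \<Rightarrow> (int ^ 'n \<Rightarrow> (rat ^ 'n) set \<Rightarrow> real) \<Rightarrow>
   ((rat ^ 'n) set \<Rightarrow> (real ^ 'n \<Rightarrow> complex) \<Rightarrow> complex) set" where
  "data_space d r w = {g. (\<forall>A\<in>Gr d. g A \<in> distributions) \<and> data_normsq d r w g < \<infinity>}"

definition data_inner ::
  "nat \<Rightarrow> real \<Rightarrow> (int ^ 'n \<Rightarrow> (rat ^ 'n) set \<Rightarrow> real) \<Rightarrow>
   ((rat ^ 'n) set \<Rightarrow> (real ^ 'n \<Rightarrow> complex) \<Rightarrow> complex) \<Rightarrow>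
   ((rat ^ 'n) set \<Rightarrow> (real ^ 'n \<Rightarrow> complex) \<Rightarrow> complex) \<Rightarrow> complex" where
  "data_inner d r w g h = (\<Sum>\<^sub>\<infinity>A\<in>Gr d.
     sobolev_inner r (fmult (\<lambda>k. w k A) (g A)) (fmult (\<lambda>k. w k A) (h A)))"

section \<open>The adjoint and the regularizing multiplier\<close>

text \<open>The Hilbert space adjoint of \<open>radon\<close> from \<open>sobolev r\<close> to \<open>data_space d r w\<close>.  When \<open>W d w\<close> is
  bounded it has Fourier coefficients \<open>\<Sum>A\<in>Omega d k. w(k,A)\<^sup>2 * fcoeff (g A) k\<close>.\<close>

definition radon_adjoint ::
  "nat \<Rightarrow> real \<Rightarrow> (int ^ 'n \<Rightarrow> (rat ^ 'n) set \<Rightarrow> real) \<Rightarrow>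
   ((rat ^ 'n) set \<Rightarrow> (real ^ 'n \<Rightarrow> complex) \<Rightarrow> complex) \<Rightarrow> (real ^ 'n \<Rightarrow> complex) \<Rightarrow> complex" where
  "radon_adjoint d r w g =
    (THE h. h \<in> sobolev r \<and>
      (\<forall>f\<in>sobolev r. data_inner d r w (radon f) g = sobolev_inner r f h))"

definition P_mult ::
  "nat \<Rightarrow> (int ^ 'n \<Rightarrow> (rat ^ 'n) set \<Rightarrow> real) \<Rightarrow> real \<Rightarrow> real \<Rightarrow>
   ((real ^ 'n \<Rightarrow> complex) \<Rightarrow> complex) \<Rightarrow> (real ^ 'n \<Rightarrow> complex) \<Rightarrow> complex" where
  "P_mult d w z \<alpha> = fmult (\<lambda>k. 1 / (enn2real (W d w k) + \<alpha> * bracket k powr (2 * z)))"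

definition tikhonov ::
  "nat \<Rightarrow> real \<Rightarrow> real \<Rightarrow> (int ^ 'n \<Rightarrow> (rat ^ 'n) set \<Rightarrow> real) \<Rightarrow> real \<Rightarrow>
   ((rat ^ 'n) set \<Rightarrow> (real ^ 'n \<Rightarrow> complex) \<Rightarrow> complex) \<Rightarrow>
   ((real ^ 'n \<Rightarrow> complex) \<Rightarrow> complex) \<Rightarrow> ennreal" where
  "tikhonov d r s w \<alpha> g f =
    data_normsq d r w (\<lambda>A. minus_distr (radon f A) (g A)) + ennreal \<alpha> * sobolev_normsq s f"

end

theory Submission
  imports Defs
begin

text \<open>Fourier coefficients turn the functional into a sum of independent quadratic functions.  A periodic
  distribution is determined by its Fourier coefficients, and every polynomially bounded family is
  the coefficient family of one: the Fourier coefficients of a test function decay rapidly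
  (integration by parts), and its Fourier series converges with all derivatives (Stone--Weierstrass).
  The Radon transform over \<open>A\<close> keeps the coefficients with \<open>k \<bottom> A\<close> and kills the others, since the integral of
  \<open>e\<^bsup>2\<pi>imt\<^esup>\<close> over \<open>[0,1]\<close> vanishes for integers \<open>m \<noteq> 0\<close>.  Interchanging the sums over \<open>A\<close> and \<open>k\<close>, the contribution of
  the mode \<open>k\<close> is, with \<open>h\<^sub>k\<close> the coefficient of \<open>R\<^sub>d\<^sup>*g\<close>,
  \<open>\<langle>k\<rangle>\<^bsup>2r\<^esup> ((W\<^sub>k + \<alpha>\<langle>k\<rangle>\<^bsup>2(s-r)\<^esup>) |z|\<^sup>2 - 2 Re (z cnj h\<^sub>k) + const)\<close> at \<open>z = \<close> the coefficient of \<open>f\<close>, and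
  completing the square gives the minimizer.  Its total value is finite, so the strict inequality
  survives the summation in \<open>[0,\<infinity>]\<close>.\<close>

section \<open>Characters and test functions\<close>

text \<open>A weight may grow arbitrarily in k for fixed A, and \<open>radon_adjoint\<close> is
  specified only through inner products, so neither the finiteness of the weighted data nor the
  coefficient formula for the adjoint is immediate. The bound W_k \<le> C^2 settles three points. A
  single weight with k perpendicular to A satisfies |w(k,A)| \<le> C, so the weighted transform of
  every distribution still has polynomially bounded coefficients, and the functional equals its mode
  sum for all f, with the value \<infinity> allowed. The misfit in each mode is nonnegative for
  every z, which forces |h_k|^2 \<le> C^2 D_k, where D_k is the weighted energy of the data in mode
  k; hence the h_k are the coefficients of an element of H^r. The mixed terms satisfy w^2 |z g|
  \<le> w^2 |z|^2 + w^2 |g|^2, so the complex double sum that identifies the adjoint converges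
  absolutely. The exponent 2s - r is r + 2(s - r): the penalty alone makes the symbol of P at most
  1/\<alpha> times the power -2(s - r) of the bracket.\<close>

definition tchar :: "int ^ 'n \<Rightarrow> real ^ 'n \<Rightarrow> complex" where
  "tchar k x = cis (2 * pi * (lat k \<bullet> x))"

lemma lat_add: "lat (k + j) = lat k + lat j"
  by (simp add: lat_def vec_eq_iff)

lemma lat_minus: "lat (- k) = - lat k"
  by (simp add: lat_def vec_eq_iff)

lemma lat_zero [simp]: "lat 0 = 0"
  by (simp add: lat_def vec_eq_iff)

lemma lat_inner_lat:
  "lat k \<bullet> (lat v :: real ^ 'n) = of_int (\<Sum>i\<in>UNIV. (k :: int ^ 'n) $ i * v $ i)"
  by (simp add: lat_def inner_vec_def)

lemma lat_inner_axis [simp]: "lat k \<bullet> (axis i 1 :: real ^ 'n) = of_int (k $ i)"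
  by (simp add: lat_def inner_axis)

lemma tchar_zero [simp]: "tchar 0 x = 1"
  by (simp add: tchar_def)

lemma norm_tchar [simp]: "norm (tchar k x) = 1"
  by (simp add: tchar_def)

lemma tchar_neq_0 [simp]: "tchar k x \<noteq> 0"
  by (simp add: tchar_def)

lemma tchar_mult: "tchar j x * tchar k x = tchar (j + k) x"
  by (simp add: tchar_def cis_mult lat_add inner_add_left ring_distribs)

lemma tchar_add: "tchar k (x + y) = tchar k x * tchar k y"
  by (simp add: tchar_def cis_mult inner_add_right ring_distribs)

lemma cnj_tchar: "cnj (tchar k x) = tchar (- k) x"
  by (simp add: tchar_def cis_cnj lat_minus)

lemma tchar_lat [simp]: "tchar k (lat v) = 1"
  unfolding tchar_def lat_inner_lat
  by (metis Ints_of_int cis_multiple_2pi)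

lemma tchar_periodic: "tchar k (x + lat v) = tchar k x"
  by (simp add: tchar_add)

text \<open>A coefficient pairs with the conjugate character. This is the origin of the index
  \<open>- k\<close> in all later formulas.\<close>

lemma fcoeff_eq: "fcoeff u k = u (tchar (- k))"
proof -
  have "(\<lambda>x. exp (- 2 * complex_of_real pi * \<i> * complex_of_real (lat k \<bullet> x))) = tchar (- k)"
    by (auto simp: tchar_def cis_conv_exp lat_minus fun_eq_iff mult_ac)
  then show ?thesis
    by (simp add: fcoeff_def)
qed

lemma has_derivative_tchar:
  "(tchar k has_derivative (\<lambda>h. 2 * pi * \<i> * (lat k \<bullet> h) * tchar k x)) (at x)"
  unfolding tchar_def
  by (rule derivative_eq_intros refl)+ (simp add: scaleR_conv_of_real mult_ac)

lemma continuous_on_tchar [continuous_intros]: "continuous_on S (tchar k)"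
  by (meson continuous_at_imp_continuous_on has_derivative_continuous has_derivative_tchar)

lemma differentiable_tchar [simp]: "tchar k differentiable (at x)"
  using has_derivative_tchar differentiable_def by blast

lemma partial_eqI:
  assumes "(f has_derivative f') (at x)"
  shows "partial i f x = f' (axis i 1)"
  using frechet_derivative_at[OF assms] by (simp add: partial_def)

lemma partial_add:
  assumes "f differentiable (at x)" "g differentiable (at x)"
  shows "partial i (\<lambda>x. f x + g x) x = partial i f x + partial i g x"
proof -
  have "((\<lambda>x. f x + g x) has_derivative
     (\<lambda>h. frechet_derivative f (at x) h + frechet_derivative g (at x) h)) (at x)"
    using assms by (intro has_derivative_add) (auto simp: frechet_derivative_works[symmetric])
  then show ?thesis
    by (subst partial_eqI) (auto simp: partial_def)
qed

lemma partial_mult: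
  assumes "f differentiable (at x)" "g differentiable (at x)"
  shows "partial i (\<lambda>x. f x * g x) x = f x * partial i g x + partial i f x * g x"
proof -
  have "((\<lambda>x. f x * g x) has_derivative
     (\<lambda>h. f x * frechet_derivative g (at x) h + frechet_derivative f (at x) h * g x)) (at x)"
    using assms by (intro has_derivative_mult) (auto simp: frechet_derivative_works[symmetric])
  then show ?thesis
    by (subst partial_eqI) (auto simp: partial_def)
qed

lemma partial_cmult:
  assumes "f differentiable (at x)"
  shows "partial i (\<lambda>x. c * f x) x = c * partial i f x"
proof -
  have "((\<lambda>x. c * f x) has_derivative (\<lambda>h. c * frechet_derivative f (at x) h)) (at x)"
    using assms by (intro derivative_intros) (auto simp: frechet_derivative_works[symmetric])
  then show ?thesis
    by (subst partial_eqI) (auto simp: partial_def)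
qed

lemma partial_tchar: "partial i (tchar k) x = 2 * pi * \<i> * of_int (k $ i) * tchar k x"
  by (simp add: partial_eqI[OF has_derivative_tchar])

lemma partial_periodic:
  assumes "\<And>x v. f (x + lat v) = f x" "\<And>x. f differentiable (at x)"
  shows "partial i f (x + lat v) = partial i f x"
proof -
  have "(f has_derivative frechet_derivative f (at (x + lat v))) (at (x + lat v))"
    using assms(2) frechet_derivative_works by blast
  moreover have "((\<lambda>y. y + lat v) has_derivative (\<lambda>h. h)) (at x)"
    by (auto intro!: derivative_eq_intros)
  ultimately have "((\<lambda>y. f (y + lat v)) has_derivative frechet_derivative f (at (x + lat v))) (at x)"
    using has_derivative_compose[of "\<lambda>y. y + lat v" "\<lambda>h. h" x UNIV f] by simp
  then have "(f has_derivative frechet_derivative f (at (x + lat v))) (at x)"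
    by (simp add: assms(1))
  then show ?thesis
    by (subst (2) partial_eqI) (auto simp: partial_def)
qed

lemma partials_Nil [simp]: "partials [] f = f"
  by (simp add: partials_def)

lemma partials_Cons [simp]: "partials (i # is) f = partial i (partials is f)"
  by (simp add: partials_def)

lemma partials_snoc: "partials (is @ [i]) f = partials is (partial i f)"
  by (simp add: partials_def)

lemma test_funs_differentiable: "f \<in> test_funs \<Longrightarrow> f differentiable (at x)"
  unfolding test_funs_def by (metis (mono_tags, lifting) mem_Collect_eq partials_Nil)

lemma test_funs_periodic: "f \<in> test_funs \<Longrightarrow> f (x + lat v) = f x"
  by (simp add: test_funs_def)

text \<open>Appending a direction to the multi-index (\<open>partials_snoc\<close>) makes every
  iterated derivative of \<open>partial i f\<close> one of \<open>f\<close> itself, so smoothness is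
  inherited directly from the definition.\<close>

lemma partial_test_funs: "f \<in> test_funs \<Longrightarrow> partial i f \<in> test_funs"
  using partial_periodic[of f] test_funs_differentiable[of f]
  unfolding test_funs_def mem_Collect_eq partials_snoc[symmetric] by blast

lemma partials_test_funs: "f \<in> test_funs \<Longrightarrow> partials is f \<in> test_funs"
  by (induction "is") (auto simp: partial_test_funs)

lemma partials_linear:
  assumes f: "f \<in> test_funs" and g: "g \<in> test_funs"
  shows "partials is (\<lambda>x. f x + c * g x) = (\<lambda>x. partials is f x + c * partials is g x)"
proof (induction "is")
  case (Cons i "is")
  have d: "partials is f differentiable (at x)" "partials is g differentiable (at x)" for x
    using f g partials_test_funs test_funs_differentiable by blast+
  show ?case
    using d by (simp add: Cons.IH fun_eq_iff partial_add partial_cmult)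
qed simp

lemma test_funs_linear:
  assumes "f \<in> test_funs" "g \<in> test_funs"
  shows "(\<lambda>x. f x + c * g x) \<in> test_funs"
proof -
  have "partials is f differentiable (at x)" "partials is g differentiable (at x)" for "is" x
    using assms partials_test_funs test_funs_differentiable by blast+
  then show ?thesis
    using assms unfolding test_funs_def
    by (auto simp: partials_linear[OF assms])
qed

lemma partials_tchar:
  "partials is (tchar k) = (\<lambda>x. (\<Prod>i\<leftarrow>is. 2 * pi * \<i> * of_int (k $ i)) * tchar k x)"
proof (induction "is")
  case (Cons i "is")
  show ?case
    unfolding partials_Cons Cons.IH
    by (rule ext, subst partial_cmult) (simp_all add: partial_tchar mult_ac)
qed simp

lemma tchar_test_funs: "tchar k \<in> test_funs"
  by (auto simp: test_funs_def tchar_periodic partials_tchar)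

lemma zero_test_funs: "(\<lambda>x. 0) \<in> test_funs"
  using test_funs_linear[OF tchar_test_funs[of 0] tchar_test_funs[of 0], where c = "-1"] by simp

lemma cmult_test_funs: "f \<in> test_funs \<Longrightarrow> (\<lambda>x. c * f x) \<in> test_funs"
  using test_funs_linear[OF zero_test_funs] by simp

lemma sum_test_funs:
  assumes "finite F" "\<And>k. k \<in> F \<Longrightarrow> f k \<in> test_funs"
  shows "(\<lambda>x. \<Sum>k\<in>F. c k * f k x) \<in> test_funs"
  using assms
proof (induction F rule: finite_induct)
  case (insert k F)
  then show ?case
    using test_funs_linear[of "\<lambda>x. \<Sum>k\<in>F. c k * f k x" "f k" "c k"] by (simp add: add.commute)
qed (simp add: zero_test_funs)

lemma partials_cmult:
  assumes "f \<in> test_funs"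
  shows "partials is (\<lambda>x. c * f x) = (\<lambda>x. c * partials is f x)"
proof -
  have "partials is (\<lambda>x. 0) = (\<lambda>x. 0)"
    using partials_linear[OF assms assms, of "is" "-1"] by simp
  then show ?thesis
    using partials_linear[OF zero_test_funs assms, of "is" c] by simp
qed

lemma partials_sum:
  assumes "finite F" "\<And>k. k \<in> F \<Longrightarrow> f k \<in> test_funs"
  shows "partials is (\<lambda>x. \<Sum>k\<in>F. c k * f k x) = (\<lambda>x. \<Sum>k\<in>F. c k * partials is (f k) x)"
  using assms
proof (induction F rule: finite_induct)
  case (insert k F)
  then show ?case
    using partials_linear[OF sum_test_funs[of F f c], of "f k" "is" "c k"]
    by (simp add: add.commute)
qed (use partials_cmult[OF tchar_test_funs, of "is" 0] in simp)

lemma continuous_on_test_funs: "f \<in> test_funs \<Longrightarrow> continuous_on S f"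
  by (simp add: continuous_at_imp_continuous_on differentiable_imp_continuous_within
      test_funs_differentiable)

section \<open>Bounds for periodic functions and the norms \<open>Cm_norm\<close>\<close>

lemma in_unit_cube: "\<exists>v. x + lat v \<in> cbox 0 (1 :: real ^ 'n)"
proof -
  have "x + lat (\<chi> i. - \<lfloor>x $ i\<rfloor>) \<in> cbox 0 1"
    unfolding mem_box_cart lat_def by (simp add: floor_correct) linarith
  then show ?thesis by blast
qed

lemma periodic_bounded:
  fixes f :: "real ^ 'n \<Rightarrow> complex"
  assumes per: "\<And>x v. f (x + lat v) = f x" and cont: "continuous_on UNIV f"
  obtains B where "\<And>x. norm (f x) \<le> B"
proof -
  have "bounded (f ` cbox 0 1)"
    by (meson cont compact_cbox compact_continuous_image compact_imp_bounded
        continuous_on_subset subset_UNIV)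
  then obtain B where B: "\<And>x. x \<in> cbox 0 1 \<Longrightarrow> norm (f x) \<le> B"
    unfolding bounded_iff by blast
  have "norm (f x) \<le> B" for x
    using in_unit_cube[of x] B per by metis
  then show ?thesis using that by blast
qed

text \<open>\<open>Cm_norm\<close> is built from real suprema, which dominate their members only
  when the range is bounded. Periodicity reduces this to the compact unit cube.\<close>

lemma bdd_above_test_fun: "f \<in> test_funs \<Longrightarrow> bdd_above (range (\<lambda>x. cmod (f x)))"
proof -
  assume f: "f \<in> test_funs"
  obtain B where "\<And>x. norm (f x) \<le> B"
    using periodic_bounded[OF test_funs_periodic[OF f] continuous_on_test_funs[OF f]] by blast
  then show ?thesis
    by (intro bdd_aboveI2)
qed

lemma finite_short_lists: "finite {is :: 'n::finite list. length is \<le> m}"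
  using finite_lists_length_le[of "UNIV :: 'n set" m] by simp

lemma norm_partials_le_Cm_norm:
  assumes "f \<in> test_funs" "length is \<le> m"
  shows "cmod (partials is f x) \<le> Cm_norm m f"
proof -
  have bdd: "bdd_above (range (\<lambda>x. cmod (partials js f x)))" for js
    by (rule bdd_above_test_fun[OF partials_test_funs[OF assms(1)]])
  have nonneg: "0 \<le> (SUP x. cmod (partials js f x))" for js
    by (rule order_trans[OF norm_ge_zero cSUP_upper[OF UNIV_I bdd]])
  have "cmod (partials is f x) \<le> (SUP x. cmod (partials is f x))"
    by (rule cSUP_upper[OF UNIV_I bdd])
  also have "\<dots> \<le> Cm_norm m f"
    unfolding Cm_norm_def
    by (rule member_le_sum) (use assms nonneg finite_short_lists in auto)
  finally show ?thesis .
qed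

text \<open>\<open>Cm_norm\<close> adds the suprema instead of taking their maximum, hence the
  number of multi-indices as a factor.\<close>

lemma Cm_norm_le:
  fixes f :: "real ^ 'n \<Rightarrow> complex"
  assumes "\<And>is x. length is \<le> m \<Longrightarrow> cmod (partials is f x) \<le> B"
  shows "Cm_norm m f \<le> real (card {is :: 'n list. length is \<le> m}) * B"
  unfolding Cm_norm_def by (rule sum_bounded_above) (auto intro!: cSUP_least assms)

section \<open>Growth of the bracket, of characters and of coefficients\<close>

lemma bracket_ge_1: "1 \<le> bracket k"
  by (simp add: bracket_def)

lemma bracket_pos [simp]: "0 < bracket k"
  using bracket_ge_1[of k] by linarith

lemma bracket_minus [simp]: "bracket (- k) = bracket k"
  by (simp add: bracket_def lat_minus)

lemma bracket_sq: "(bracket k)\<^sup>2 = 1 + (\<Sum>i\<in>UNIV. (of_int (k $ i))\<^sup>2)"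
proof -
  have "(norm (lat k :: real ^ 'n))\<^sup>2 = (\<Sum>i\<in>UNIV. (of_int (k $ i))\<^sup>2)" for k :: "int ^ 'n"
    by (simp add: norm_vec_def L2_set_def lat_def sum_nonneg)
  then show ?thesis
    by (simp add: bracket_def real_sqrt_pow2 add_nonneg_nonneg)
qed

lemma component_le_bracket: "\<bar>of_int (k $ i)\<bar> \<le> bracket k"
proof (rule power2_le_imp_le)
  have "(of_int (k $ i))\<^sup>2 \<le> (\<Sum>i\<in>UNIV. (of_int (k $ i) :: real)\<^sup>2)"
    by (rule member_le_sum) auto
  then show "\<bar>of_int (k $ i)\<bar>\<^sup>2 \<le> (bracket k)\<^sup>2"
    by (simp add: bracket_sq)
qed (use bracket_ge_1[of k] in linarith)

lemma norm_prod_list_le: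
  fixes c :: "'a \<Rightarrow> complex"
  assumes "\<And>i. norm (c i) \<le> B"
  shows "norm (\<Prod>i\<leftarrow>is. c i) \<le> B ^ length is"
proof (induction "is")
  case (Cons i "is")
  then show ?case
    using assms[of i] by (simp add: norm_mult mult_mono order_trans[OF norm_ge_zero assms[of i]])
qed simp

lemma norm_partials_tchar_le:
  assumes "length is \<le> m"
  shows "norm (partials is (tchar k) x) \<le> (2 * pi * bracket k) ^ m"
proof -
  have "norm (partials is (tchar k) x) \<le> (2 * pi * bracket k) ^ length is"
    unfolding partials_tchar norm_mult norm_tchar mult_1_right
    by (rule norm_prod_list_le) (use component_le_bracket in \<open>auto simp: norm_mult\<close>)
  also have "\<dots> \<le> (2 * pi * bracket k) ^ m"
  proof (rule power_increasing[OF assms])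
    have "1 * 1 \<le> (2 * pi) * bracket k"
      using bracket_ge_1[of k] pi_ge_two by (intro mult_mono) auto
    then show "1 \<le> 2 * pi * bracket k" by simp
  qed
  finally show ?thesis .
qed

text \<open>Apply the continuity estimate of order m to the characters, whose derivatives up to that
  order cost at most (2 pi \<open>bracket k\<close>)^m. The constant in \<open>distributions\<close>
  has no prescribed sign, hence its absolute value.\<close>

lemma fcoeff_poly_bound:
  assumes "u \<in> distributions"
  obtains B N where "B \<ge> 0" "\<And>k. cmod (fcoeff u k) \<le> B * bracket k ^ N"
proof -
  from assms obtain m C where C: "\<And>\<phi>. \<phi> \<in> test_funs \<Longrightarrow> cmod (u \<phi>) \<le> C * Cm_norm m \<phi>"
    unfolding distributions_def by blast
  let ?L = "real (card {is :: 'a list. length is \<le> m})"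
  have "cmod (fcoeff u k) \<le> (\<bar>C\<bar> * ?L * (2 * pi) ^ m) * bracket k ^ m" for k
  proof -
    have nonneg: "0 \<le> Cm_norm m (tchar (- k))"
      by (rule order_trans[OF norm_ge_zero norm_partials_le_Cm_norm[OF tchar_test_funs, of "[]"]]) simp
    have "cmod (fcoeff u k) \<le> C * Cm_norm m (tchar (- k))"
      unfolding fcoeff_eq by (rule C[OF tchar_test_funs])
    also have "\<dots> \<le> \<bar>C\<bar> * Cm_norm m (tchar (- k))"
      using nonneg by (intro mult_right_mono) auto
    also have "\<dots> \<le> \<bar>C\<bar> * (?L * (2 * pi * bracket k) ^ m)"
      by (intro mult_left_mono Cm_norm_le) (auto intro: norm_partials_tchar_le[of _ m "- k", unfolded bracket_minus])
    finally show ?thesis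
      by (simp add: power_mult_distrib mult_ac)
  qed
  moreover have "0 \<le> \<bar>C\<bar> * ?L * (2 * pi) ^ m" by simp
  ultimately show ?thesis using that by blast
qed

section \<open>Fourier coefficients on the torus\<close>

definition tmean :: "(real ^ 'n \<Rightarrow> complex) \<Rightarrow> complex" where
  "tmean f = integral (cbox 0 1) f"

lemma unit_cube_content: "measure lborel (cbox 0 (1 :: real ^ 'n)) = 1"
  by (subst content_cbox_cart) (auto simp: interval_ne_empty_cart)

lemma cont_integrable:
  fixes f :: "real ^ 'n \<Rightarrow> complex"
  shows "continuous_on UNIV f \<Longrightarrow> f integrable_on cbox a b"
  by (meson continuous_on_subset integrable_continuous subset_UNIV)

lemma tmean_linear:
  assumes "continuous_on UNIV f" "continuous_on UNIV g"
  shows "tmean (\<lambda>x. f x + c * g x) = tmean f + c * tmean g"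
  unfolding tmean_def
  using assms by (simp add: integral_add integral_mult_right cont_integrable integrable_on_mult_right)

lemma tmean_cmult: "tmean (\<lambda>x. c * f x) = c * tmean f"
  by (simp add: tmean_def integral_mult_right)

lemma tmean_sum:
  assumes "finite F" "\<And>k. k \<in> F \<Longrightarrow> continuous_on UNIV (f k)"
  shows "tmean (\<lambda>x. \<Sum>k\<in>F. c k * f k x) = (\<Sum>k\<in>F. c k * tmean (f k))"
  unfolding tmean_def
  using assms by (simp add: integral_sum integral_mult_right cont_integrable integrable_on_mult_right)

lemma norm_tmean_le:
  fixes f :: "real ^ 'n \<Rightarrow> complex"
  assumes "continuous_on UNIV f" "\<And>x. norm (f x) \<le> B"
  shows "norm (tmean f) \<le> B"
proof -
  have "norm (tmean f) \<le> B * measure lborel (cbox 0 (1 :: real ^ 'n))"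
  proof (rule has_integral_bound)
    show "(f has_integral tmean f) (cbox 0 1)"
      unfolding tmean_def using cont_integrable[OF assms(1)] integrable_integral by blast
    show "0 \<le> B"
      using assms(2) norm_ge_zero order_trans by blast
  qed (use assms in auto)
  then show ?thesis
    by (simp add: unit_cube_content)
qed

text \<open>Compares two boxes that differ in one coordinate: the half-space condition attached to a
  box is absorbed into the inequalities for that coordinate.\<close>

lemma all_conj_iff_single:
  assumes "\<And>j. j \<noteq> i \<Longrightarrow> P j \<longleftrightarrow> R j" "P i \<and> Q \<longleftrightarrow> R i \<and> S"
  shows "(\<forall>j. P j) \<and> Q \<longleftrightarrow> (\<forall>j. R j) \<and> S"
  using assms by metis

text \<open>The translated cube is cut along the hyperplane where the \<open>i\<close>-th coordinate is 1; the part beyond it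
  is moved back by one period.\<close>

lemma tmean_translate:
  fixes f :: "real ^ 'n \<Rightarrow> complex"
  assumes cont: "continuous_on UNIV f" and per: "\<And>x v. f (x + lat v) = f x"
    and t: "0 \<le> t" "t \<le> 1"
  shows "tmean (\<lambda>x. f (x + t *\<^sub>R axis i 1)) = tmean f"
proof -
  define e :: "real ^ 'n" where "e = axis i 1"
  have e_nth: "e $ j = (if j = i then 1 else 0)" for j
    by (simp add: e_def axis_def)
  have e_basis: "e \<in> Basis"
    by (simp add: e_def axis_in_Basis_iff)
  have inner_e: "x \<bullet> e = x $ i" for x
    by (simp add: e_def inner_axis)
  have e_lat: "e = lat (axis i 1)"
    by (auto simp: e_def lat_def vec_eq_iff axis_def)
  have int: "f integrable_on cbox a b" for a b
    by (rule cont_integrable[OF cont])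
  have "tmean (\<lambda>x. f (x + t *\<^sub>R e)) = integral (cbox 0 1) (f \<circ> (+) (t *\<^sub>R e))"
    by (simp add: tmean_def o_def add.commute)
  also have "\<dots> = integral (cbox (t *\<^sub>R e) (1 + t *\<^sub>R e)) f"
    by (simp add: integral_shift_cbox_plus)
  also have "\<dots> = integral (cbox (t *\<^sub>R e) (1 + t *\<^sub>R e) \<inter> {x. x \<bullet> e \<le> 1}) f +
      integral (cbox (t *\<^sub>R e) (1 + t *\<^sub>R e) \<inter> {x. x \<bullet> e \<ge> 1}) f"
    by (rule integral_split[OF int e_basis])
  also have "cbox (t *\<^sub>R e) (1 + t *\<^sub>R e) \<inter> {x. x \<bullet> e \<le> 1} = cbox 0 1 \<inter> {x. x \<bullet> e \<ge> t}"
  proof (rule set_eqI)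
    fix x :: "real ^ 'n"
    have "(\<forall>j. t * e $ j \<le> x $ j \<and> x $ j \<le> 1 + t * e $ j) \<and> x $ i \<le> 1 \<longleftrightarrow>
       (\<forall>j. 0 \<le> x $ j \<and> x $ j \<le> 1) \<and> t \<le> x $ i"
      by (rule all_conj_iff_single[where i = i]) (use t in \<open>auto simp: e_nth\<close>)
    then show "x \<in> cbox (t *\<^sub>R e) (1 + t *\<^sub>R e) \<inter> {x. x \<bullet> e \<le> 1} \<longleftrightarrow>
        x \<in> cbox 0 1 \<inter> {x. x \<bullet> e \<ge> t}"
      by (simp add: mem_box_cart inner_e)
  qed
  also have "cbox (t *\<^sub>R e) (1 + t *\<^sub>R e) \<inter> {x. x \<bullet> e \<ge> 1} = cbox (0 + e) ((1 + t *\<^sub>R e - e) + e)"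
  proof (rule set_eqI)
    fix x :: "real ^ 'n"
    have "(\<forall>j. t * e $ j \<le> x $ j \<and> x $ j \<le> 1 + t * e $ j) \<and> 1 \<le> x $ i \<longleftrightarrow>
       (\<forall>j. e $ j \<le> x $ j \<and> x $ j \<le> 1 + t * e $ j) \<and> True"
      by (rule all_conj_iff_single[where i = i]) (use t in \<open>auto simp: e_nth\<close>)
    then show "x \<in> cbox (t *\<^sub>R e) (1 + t *\<^sub>R e) \<inter> {x. x \<bullet> e \<ge> 1} \<longleftrightarrow>
        x \<in> cbox (0 + e) ((1 + t *\<^sub>R e - e) + e)"
      by (simp add: mem_box_cart inner_e)
  qed
  also have "integral (cbox (0 + e) ((1 + t *\<^sub>R e - e) + e)) f =
      integral (cbox 0 (1 + t *\<^sub>R e - e)) (f \<circ> (+) e)"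
    by (rule integral_shift_cbox_plus[symmetric])
  also have "f \<circ> (+) e = f"
    using per by (auto simp: e_lat fun_eq_iff add.commute)
  also have "cbox 0 (1 + t *\<^sub>R e - e) = cbox 0 1 \<inter> {x. x \<bullet> e \<le> t}"
  proof (rule set_eqI)
    fix x :: "real ^ 'n"
    have "(\<forall>j. 0 \<le> x $ j \<and> x $ j \<le> 1 + t * e $ j - e $ j) \<and> True \<longleftrightarrow>
       (\<forall>j. 0 \<le> x $ j \<and> x $ j \<le> 1) \<and> x $ i \<le> t"
      by (rule all_conj_iff_single[where i = i]) (use t in \<open>auto simp: e_nth\<close>)
    then show "x \<in> cbox 0 (1 + t *\<^sub>R e - e) \<longleftrightarrow> x \<in> cbox 0 1 \<inter> {x. x \<bullet> e \<le> t}"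
      by (simp add: mem_box_cart inner_e)
  qed
  also have "integral (cbox 0 1 \<inter> {x. x \<bullet> e \<ge> t}) f + integral (cbox 0 1 \<inter> {x. x \<bullet> e \<le> t}) f
      = tmean f"
    unfolding tmean_def by (subst integral_split[OF int e_basis, of _ _ t]) simp
  finally show ?thesis
    by (simp add: e_def)
qed

lemma tmean_tchar: "tmean (tchar k) = (if k = 0 then 1 else 0)"
proof (cases "k = 0")
  case True
  have "tmean (\<lambda>x :: real ^ 'a. 1) = 1"
    by (simp add: tmean_def unit_cube_content)
  with True show ?thesis
    by (metis (no_types, lifting) ext tchar_zero)
next
  case False
  then obtain i where i: "k $ i \<noteq> 0"
    by (auto simp: vec_eq_iff)
  \<comment> \<open>A translation that multiplies the character by \<open>-1\<close>.\<close>
  define t :: real where "t = 1 / (2 * \<bar>of_int (k $ i)\<bar>)"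
  have "1 \<le> \<bar>k $ i\<bar>" using i by linarith
  then have "1 \<le> \<bar>of_int (k $ i) :: real\<bar>" by linarith
  then have t: "0 \<le> t" "t \<le> 1"
    by (auto simp: t_def field_simps)
  have kt: "of_int (k $ i) * t = 1 / 2 \<or> of_int (k $ i) * t = - 1 / 2"
    using i by (auto simp: t_def abs_if field_simps)
  have "tchar k (t *\<^sub>R axis i 1) = cis (2 * pi * (of_int (k $ i) * t))"
    by (simp add: tchar_def mult_ac)
  also have "\<dots> = -1"
    using kt
  proof
    assume "of_int (k $ i) * t = 1 / 2"
    then show ?thesis by (simp only:) simp
  next
    assume "of_int (k $ i) * t = - 1 / 2"
    then show ?thesis by (simp only:) (simp add: complex_eq_iff)
  qed
  finally have "tmean (\<lambda>x. tchar k (x + t *\<^sub>R axis i 1)) = tmean (\<lambda>x. - 1 * tchar k x)"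
    by (simp add: tchar_add)
  also have "\<dots> = - tmean (tchar k)"
    by (subst tmean_cmult) simp
  finally have "tmean (tchar k) = - tmean (tchar k)"
    using tmean_translate[OF continuous_on_tchar tchar_periodic t, of k i] by metis
  with False show ?thesis by simp
qed

section \<open>Integration by parts and rapid decay of Fourier coefficients\<close>

lemma has_vector_derivative_partial:
  assumes "\<And>x. f differentiable (at x)"
  shows "((\<lambda>t. f (x + t *\<^sub>R axis i 1)) has_vector_derivative partial i f (x + t *\<^sub>R axis i 1))
           (at t within T)"
proof -
  have "(f has_derivative frechet_derivative f (at (x + t *\<^sub>R axis i 1))) (at (x + t *\<^sub>R axis i 1))"
    using assms frechet_derivative_works by blast
  moreover have "((\<lambda>t. x + t *\<^sub>R axis i 1) has_derivative (\<lambda>h. h *\<^sub>R axis i 1)) (at t within T)"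
    by (auto intro!: derivative_eq_intros)
  ultimately have "((\<lambda>t. f (x + t *\<^sub>R axis i 1)) has_derivative
      (\<lambda>h. frechet_derivative f (at (x + t *\<^sub>R axis i 1)) (h *\<^sub>R axis i 1))) (at t within T)"
    by (rule has_derivative_compose[rotated])
  moreover have "linear (frechet_derivative f (at (x + t *\<^sub>R axis i 1)))"
    by (rule linear_frechet_derivative[OF assms])
  ultimately show ?thesis
    by (simp add: has_vector_derivative_def partial_def linear_cmul)
qed

lemma tmean_partial:
  fixes f :: "real ^ 'n \<Rightarrow> complex"
  assumes per: "\<And>x v. f (x + lat v) = f x" and diff: "\<And>x. f differentiable (at x)"
    and cont: "continuous_on UNIV (partial i f)"
  shows "tmean (partial i f) = 0"
proof -
  define e :: "real ^ 'n" where "e = axis i 1"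
  have cf: "continuous_on S f" for S
    by (simp add: continuous_at_imp_continuous_on diff differentiable_imp_continuous_within)
  have shift: "continuous_on UNIV (\<lambda>x. f (x + t *\<^sub>R e))" for t
    by (intro continuous_on_compose2[OF cf[of UNIV]] continuous_intros) auto
  have deriv: "((\<lambda>t. integral (cbox 0 1) (\<lambda>x. f (x + t *\<^sub>R e))) has_vector_derivative
      integral (cbox 0 1) (\<lambda>x. partial i f (x + 0 *\<^sub>R e))) (at 0 within {0..1})"
  proof (rule leibniz_rule_vector_derivative)
    show "((\<lambda>t. f (x + t *\<^sub>R e)) has_vector_derivative partial i f (x + t *\<^sub>R e)) (at t within {0..1})"
      for t x unfolding e_def by (rule has_vector_derivative_partial[OF diff])
    show "continuous_on ({0..1} \<times> cbox 0 1) (\<lambda>(t, x). partial i f (x + t *\<^sub>R e))"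
      unfolding case_prod_unfold
      by (intro continuous_on_compose2[OF cont] continuous_intros) auto
  qed (auto intro: cont_integrable[OF shift])
  have const: "integral (cbox 0 1) (\<lambda>x. f (x + t *\<^sub>R e)) = tmean f" if "t \<in> {0..1}" for t
    using tmean_translate[OF cf per, of t i] that by (simp add: e_def tmean_def)
  \<comment> \<open>The mean of a translate does not depend on the translation; differentiate under the integral.\<close>
  have "((\<lambda>t. tmean f) has_vector_derivative integral (cbox 0 1) (\<lambda>x. partial i f (x + 0 *\<^sub>R e)))
      (at 0 within {0..1::real})"
    by (rule has_vector_derivative_transform[OF _ const[symmetric] deriv]) auto
  then have "((\<lambda>t. tmean f) has_vector_derivative tmean (partial i f)) (at 0 within {0..1::real})"
    by (simp add: tmean_def)
  moreover have "((\<lambda>t. tmean f) has_vector_derivative 0) (at 0 within {0..1::real})"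
    by simp
  ultimately show ?thesis
    using vector_derivative_unique_within_closed_interval[of 0 1 0 "\<lambda>t. tmean f" "tmean (partial i f)" 0]
    by simp
qed

text \<open>The coefficient of a function as an integral over a period, in contrast to
  \<open>fcoeff\<close>, which evaluates a functional at a character.\<close>

definition tcoef :: "(real ^ 'n \<Rightarrow> complex) \<Rightarrow> int ^ 'n \<Rightarrow> complex" where
  "tcoef f k = tmean (\<lambda>x. f x * tchar (- k) x)"

lemma tcoef_tchar: "tcoef (tchar j) k = (if j = k then 1 else 0)"
  by (simp add: tcoef_def tchar_mult tmean_tchar)

text \<open>Integration by parts without boundary terms: the derivative of the periodic product f
  times the conjugate character has mean zero.\<close>

lemma tcoef_partial:
  assumes f: "f \<in> test_funs"
  shows "tcoef (partial i f) k = 2 * pi * \<i> * of_int (k $ i) * tcoef f k"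
proof -
  let ?g = "\<lambda>x. f x * tchar (- k) x"
  have eq: "partial i ?g x = partial i f x * tchar (- k) x + (- (2 * pi * \<i> * of_int (k $ i))) * ?g x" for x
    by (subst partial_mult[OF test_funs_differentiable[OF f] differentiable_tchar])
      (simp add: partial_tchar)
  have c: "continuous_on UNIV ?g" "continuous_on UNIV (\<lambda>x. partial i f x * tchar (- k) x)"
    using f by (intro continuous_intros continuous_on_test_funs partial_test_funs; assumption)+
  have "tmean (partial i ?g) = 0"
  proof (rule tmean_partial)
    show "?g differentiable (at x)" for x
      by (intro differentiable_mult test_funs_differentiable[OF f] differentiable_tchar)
    show "continuous_on UNIV (partial i ?g)"
      unfolding eq by (intro continuous_on_add c continuous_on_mult continuous_on_const)
  qed (simp add: test_funs_periodic[OF f] tchar_periodic)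
  moreover have "tmean (partial i ?g) =
      tcoef (partial i f) k + (- (2 * pi * \<i> * of_int (k $ i))) * tcoef f k"
    unfolding eq tcoef_def by (rule tmean_linear[OF c(2) c(1)])
  ultimately show ?thesis by (simp add: algebra_simps)
qed

lemma tcoef_partials:
  "f \<in> test_funs \<Longrightarrow> tcoef (partials is f) k = (\<Prod>i\<leftarrow>is. 2 * pi * \<i> * of_int (k $ i)) * tcoef f k"
  by (induction "is") (simp_all add: tcoef_partial partials_test_funs mult_ac)

lemma norm_tcoef_le:
  assumes "continuous_on UNIV f" "\<And>x. norm (f x) \<le> B"
  shows "norm (tcoef f k) \<le> B"
  unfolding tcoef_def
  by (rule norm_tmean_le) (use assms in \<open>auto intro!: continuous_intros simp: norm_mult\<close>)

text \<open>Provides one coordinate direction in which differentiation captures the full size of k.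
  The alternative \<open>M = 1\<close> covers the vectors without a large coordinate, such as 0. The
  constant comes from 1 + n M^2 \<le> (1 + n) M^2 for M \<ge> 1.\<close>

lemma bracket_le_max_component:
  fixes k :: "int ^ 'n"
  obtains M where "bracket k \<le> (1 + real CARD('n)) * M" "M = 1 \<or> (\<exists>i. M = \<bar>of_int (k $ i)\<bar>)" "1 \<le> M"
proof -
  define M :: real where "M = Max (insert 1 (range (\<lambda>i. \<bar>of_int (k $ i)\<bar>)))"
  have ge: "x \<le> M" if "x \<in> insert 1 (range (\<lambda>i. \<bar>of_int (k $ i)\<bar>))" for x
    unfolding M_def by (rule Max_ge) (use that in auto)
  have M1: "1 \<le> M" by (rule ge) simp
  have "M \<in> insert 1 (range (\<lambda>i. \<bar>of_int (k $ i)\<bar>))"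
    unfolding M_def by (rule Max_in) auto
  moreover have "bracket k \<le> (1 + real CARD('n)) * M"
  proof (rule power2_le_imp_le)
    have "(\<Sum>i\<in>UNIV. (of_int (k $ i) :: real)\<^sup>2) \<le> (\<Sum>i\<in>(UNIV :: 'n set). M\<^sup>2)"
    proof (rule sum_mono)
      fix i
      show "(of_int (k $ i) :: real)\<^sup>2 \<le> M\<^sup>2"
        using ge[of "\<bar>of_int (k $ i)\<bar>"] by (metis abs_ge_zero insertI2 power2_abs power_mono rangeI)
    qed
    moreover have "1 \<le> M\<^sup>2" using M1 by simp
    ultimately have "(bracket k)\<^sup>2 \<le> (1 + real CARD('n)) * M\<^sup>2"
      by (simp add: bracket_sq algebra_simps)
    also have "\<dots> \<le> (1 + real CARD('n))\<^sup>2 * M\<^sup>2"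
      by (intro mult_right_mono) (auto simp: power2_eq_square)
    finally show "(bracket k)\<^sup>2 \<le> ((1 + real CARD('n)) * M)\<^sup>2"
      by (simp add: power_mult_distrib)
  qed (use M1 in simp)
  ultimately show ?thesis
    using that M1 by auto
qed

text \<open>Differentiate m times in the direction of a dominant coordinate. Each derivative
  multiplies the coefficient by a number of modulus 2 pi M \<ge> M, while the coefficient of the
  derivative stays below \<open>Cm_norm m f\<close>. For \<open>M = 1\<close> the undifferentiated
  bound is enough.\<close>

lemma tcoef_decay:
  fixes f :: "real ^ 'n \<Rightarrow> complex"
  assumes f: "f \<in> test_funs"
  shows "bracket k ^ m * norm (tcoef f k) \<le> (1 + real CARD('n)) ^ m * Cm_norm m f"
proof -
  obtain M where M: "bracket k \<le> (1 + real CARD('n)) * M"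
    "M = 1 \<or> (\<exists>i. M = \<bar>of_int (k $ i)\<bar>)" "1 \<le> M"
    by (rule bracket_le_max_component)
  have le: "norm (tcoef (partials js f) k) \<le> Cm_norm m f" if "length js \<le> m" for js
    by (rule norm_tcoef_le)
      (use f that in \<open>auto intro: norm_partials_le_Cm_norm continuous_on_test_funs partials_test_funs\<close>)
  have "M ^ m * norm (tcoef f k) \<le> Cm_norm m f"
  proof (cases "M = 1")
    case True
    then show ?thesis using le[of "[]"] by simp
  next
    case False
    with M obtain i where i: "M = \<bar>of_int (k $ i)\<bar>" by blast
    have "M ^ m * norm (tcoef f k) \<le> (2 * pi * M) ^ m * norm (tcoef f k)"
      using M(3) pi_ge_two by (intro mult_right_mono power_mono) auto
    also have "\<dots> = norm (tcoef (partials (replicate m i) f) k)"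
      by (simp add: tcoef_partials[OF f] norm_mult norm_power i prod_list_replicate)
    also have "\<dots> \<le> Cm_norm m f"
      by (rule le) simp
    finally show ?thesis .
  qed
  moreover have "bracket k ^ m \<le> (1 + real CARD('n)) ^ m * M ^ m"
    using M(1) by (metis bracket_pos less_imp_le power_mono power_mult_distrib)
  ultimately have "bracket k ^ m * norm (tcoef f k) \<le> (1 + real CARD('n)) ^ m * M ^ m * norm (tcoef f k)"
    by (intro mult_right_mono) auto
  also have "\<dots> = (1 + real CARD('n)) ^ m * (M ^ m * norm (tcoef f k))"
    by simp
  also have "\<dots> \<le> (1 + real CARD('n)) ^ m * Cm_norm m f"
    using \<open>M ^ m * norm (tcoef f k) \<le> Cm_norm m f\<close> by (intro mult_left_mono) auto
  finally show ?thesis .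
qed

section \<open>Summability over the lattice\<close>

lemma summable_on_int_inverse_square: "(\<lambda>j :: int. 1 / (1 + (of_int j)\<^sup>2) :: real) summable_on UNIV"
proof -
  have "summable (\<lambda>n. 1 / (1 + (real n)\<^sup>2))"
  proof (rule summable_comparison_test[OF _ inverse_power_summable[of 2]])
    show "\<exists>N. \<forall>n\<ge>N. norm (1 / (1 + (real n)\<^sup>2)) \<le> inverse ((real n)\<^sup>2)"
      by (rule exI[of _ 1]) (auto simp: inverse_eq_divide intro!: frac_le)
  qed simp
  then have nat: "(\<lambda>n. 1 / (1 + (real n)\<^sup>2)) summable_on UNIV"
    by (subst summable_on_UNIV_nonneg_real_iff) auto
  have "(\<lambda>j :: int. 1 / (1 + (of_int j)\<^sup>2) :: real) summable_on range int"
    using nat by (subst summable_on_reindex) (auto simp: o_def)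
  moreover have "(\<lambda>j :: int. 1 / (1 + (of_int j)\<^sup>2) :: real) summable_on range (\<lambda>n. - int n)"
    using nat by (subst summable_on_reindex) (auto simp: o_def inj_def)
  moreover have "(UNIV :: int set) = range int \<union> range (\<lambda>n. - int n)"
    by (auto intro: int_cases2)
  ultimately show ?thesis
    by (metis summable_on_union)
qed

text \<open>The exponent 2n gives each of the n factors 1 + k_i^2 its own copy of the squared
  bracket, so the terms are dominated by a product of one-dimensional summands. Over a box such
  products sum to a power of a one-dimensional sum.\<close>

lemma summable_on_bracket_power:
  "(\<lambda>k :: int ^ 'n. 1 / bracket k ^ (2 * CARD('n))) summable_on UNIV"
proof -
  define h :: "int \<Rightarrow> real" where "h j = 1 / (1 + (of_int j)\<^sup>2)" for j
  have h_pos: "0 < h j" for j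
    by (simp add: h_def add_pos_nonneg)
  have term_le: "1 / bracket k ^ (2 * CARD('n)) \<le> (\<Prod>i\<in>UNIV. h (k $ i))" for k :: "int ^ 'n"
  proof -
    have "(\<Prod>i\<in>UNIV. 1 + (of_int (k $ i) :: real)\<^sup>2) \<le> (\<Prod>i\<in>(UNIV :: 'n set). (bracket k)\<^sup>2)"
    proof (rule prod_mono)
      fix i
      have "(of_int (k $ i))\<^sup>2 \<le> (\<Sum>i\<in>UNIV. (of_int (k $ i) :: real)\<^sup>2)"
        by (rule member_le_sum) auto
      then show "0 \<le> 1 + (of_int (k $ i) :: real)\<^sup>2 \<and> 1 + (of_int (k $ i))\<^sup>2 \<le> (bracket k)\<^sup>2"
        by (simp add: bracket_sq)
    qed
    then have "(\<Prod>i\<in>UNIV. 1 + (of_int (k $ i) :: real)\<^sup>2) \<le> bracket k ^ (2 * CARD('n))"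
      by (simp add: power_mult)
    moreover have "0 < (\<Prod>i\<in>UNIV. 1 + (of_int (k $ i) :: real)\<^sup>2)"
      by (intro prod_pos) (simp add: add_pos_nonneg)
    ultimately have "1 / bracket k ^ (2 * CARD('n)) \<le> 1 / (\<Prod>i\<in>UNIV. 1 + (of_int (k $ i) :: real)\<^sup>2)"
      by (intro divide_left_mono) auto
    then show ?thesis
      by (simp add: h_def prod_dividef)
  qed
  have "sum (\<lambda>k. 1 / bracket k ^ (2 * CARD('n))) F \<le> infsum h UNIV ^ CARD('n)"
    if F: "finite F" for F :: "(int ^ 'n) set"
  proof -
    \<comment> \<open>A finite set of lattice points lies in the box of half-width \<open>N\<close>;
      the inserted 0 keeps the maximum defined for empty \<open>F\<close>.\<close>
    define N where "N = Max (insert 0 ((\<lambda>(k, i). \<bar>k $ i\<bar>) ` (F \<times> UNIV)))"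
    have N: "\<bar>k $ i\<bar> \<le> N" if "k \<in> F" for k i
      unfolding N_def by (rule Max_ge) (use that F in \<open>auto intro!: finite_imageI\<close>)
    have inj: "inj_on ($) F"
      by (auto simp: inj_on_def vec_eq_iff fun_eq_iff)
    have "sum (\<lambda>k. 1 / bracket k ^ (2 * CARD('n))) F \<le> (\<Sum>k\<in>F. \<Prod>i\<in>UNIV. h (k $ i))"
      by (intro sum_mono term_le)
    also have "\<dots> = (\<Sum>g\<in>($) ` F. \<Prod>i\<in>UNIV. h (g i))"
      by (subst sum.reindex[OF inj]) simp
    also have "\<dots> \<le> (\<Sum>g\<in>(UNIV :: 'n set) \<rightarrow>\<^sub>E {-N..N}. \<Prod>i\<in>UNIV. h (g i))"
    proof (rule sum_mono2)
      show "($) ` F \<subseteq> UNIV \<rightarrow>\<^sub>E {-N..N}"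
        using N by (auto simp: abs_le_iff PiE_iff minus_le_iff)
      show "0 \<le> (\<Prod>i\<in>UNIV. h (g i))" for g
        by (intro prod_nonneg) (auto intro: less_imp_le h_pos)
    qed (auto intro: finite_PiE)
    also have "\<dots> = (\<Prod>i\<in>(UNIV :: 'n set). \<Sum>j\<in>{-N..N}. h j)"
      by (rule prod_sum_PiE[symmetric]) auto
    also have "\<dots> = (\<Sum>j\<in>{-N..N}. h j) ^ CARD('n)"
      by simp
    also have "\<dots> \<le> infsum h UNIV ^ CARD('n)"
    proof (rule power_mono)
      show "sum h {-N..N} \<le> infsum h UNIV"
        by (rule finite_sum_le_infsum)
          (use summable_on_int_inverse_square h_pos in \<open>auto simp: h_def[abs_def] less_imp_le\<close>)
      show "0 \<le> sum h {-N..N}"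
        by (intro sum_nonneg) (auto intro: less_imp_le h_pos)
    qed
    finally show ?thesis .
  qed
  then show ?thesis
    by (intro nonneg_bounded_partial_sums_imp_summable_on[of _ _ "infsum h UNIV ^ CARD('n)"])
      (auto simp: less_imp_le intro!: eventually_finite_subsets_at_top_weakI)
qed

section \<open>Fourier series of test functions and distributions\<close>

text \<open>Generating trigonometric polynomials by rules instead of as explicit finite sums lets
  closure under products and orthogonality be proved by rule induction.\<close>

inductive trig_poly :: "(real ^ 'n \<Rightarrow> complex) \<Rightarrow> bool" where
  trig_poly_tchar: "trig_poly (tchar k)"
| trig_poly_lin: "trig_poly p \<Longrightarrow> trig_poly q \<Longrightarrow> trig_poly (\<lambda>x. a * p x + b * q x)"

lemma trig_poly_add: "trig_poly p \<Longrightarrow> trig_poly q \<Longrightarrow> trig_poly (\<lambda>x. p x + q x)"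
  using trig_poly_lin[of p q 1 1] by simp

lemma trig_poly_cmult: "trig_poly p \<Longrightarrow> trig_poly (\<lambda>x. a * p x)"
  using trig_poly_lin[of p p a 0] by simp

lemma trig_poly_const: "trig_poly (\<lambda>x. a)"
  using trig_poly_cmult[OF trig_poly_tchar[of 0], of a] by simp

lemma trig_poly_sum:
  "finite F \<Longrightarrow> (\<And>i. i \<in> F \<Longrightarrow> trig_poly (p i)) \<Longrightarrow> trig_poly (\<lambda>x. \<Sum>i\<in>F. p i x)"
  by (induction F rule: finite_induct) (auto intro: trig_poly_const trig_poly_add)

lemma trig_poly_mult: "trig_poly p \<Longrightarrow> trig_poly q \<Longrightarrow> trig_poly (\<lambda>x. p x * q x)"
proof (induction p arbitrary: q rule: trig_poly.induct)
  case (trig_poly_tchar k)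
  then show ?case
  proof (induction q rule: trig_poly.induct)
    case (trig_poly_tchar j)
    then show ?case
      unfolding tchar_mult by (rule trig_poly.trig_poly_tchar)
  next
    case (trig_poly_lin p q a b)
    then show ?case
      using trig_poly.trig_poly_lin[OF trig_poly_lin.IH, of a b] by (simp add: algebra_simps)
  qed
next
  case (trig_poly_lin p1 p2 a b)
  then show ?case
    using trig_poly.trig_poly_lin[OF trig_poly_lin.IH(1)[OF trig_poly_lin.prems]
        trig_poly_lin.IH(2)[OF trig_poly_lin.prems], of a b]
    by (simp add: algebra_simps)
qed

lemma continuous_on_trig_poly: "trig_poly p \<Longrightarrow> continuous_on S p"
  by (induction rule: trig_poly.induct) (intro continuous_intros; assumption)+

text \<open>Realizes the torus as the product of n unit circles in complex n-space, a compact set on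
  which polynomial approximation is available. Its fibres are the lattice cosets, so periodic
  functions descend to the image.\<close>

definition torus_embedding :: "real ^ 'n \<Rightarrow> complex ^ 'n" where
  "torus_embedding x = (\<chi> i. cis (2 * pi * x $ i))"

lemma torus_embedding_eqD:
  assumes "torus_embedding x = torus_embedding y"
  obtains v where "y = x + lat v"
proof -
  have "\<exists>n :: int. y $ i = x $ i + of_int n" for i
  proof -
    have "cis (2 * pi * y $ i) = cis (2 * pi * x $ i)"
      using assms by (simp add: torus_embedding_def vec_eq_iff)
    then have "sin (2 * pi * y $ i) = sin (2 * pi * x $ i) \<and> cos (2 * pi * y $ i) = cos (2 * pi * x $ i)"
      by (simp add: complex_eq_iff)
    then obtain n :: int where "2 * pi * y $ i = 2 * pi * x $ i + 2 * pi * n"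
      unfolding sin_cos_eq_iff by blast
    then have "2 * pi * (y $ i) = 2 * pi * (x $ i + n)"
      by (simp add: algebra_simps)
    then show ?thesis
      by auto
  qed
  then obtain n :: "_ \<Rightarrow> int" where "\<And>i. y $ i = x $ i + of_int (n i)"
    by metis
  then have "y = x + lat (\<chi> i. n i)"
    by (simp add: lat_def vec_eq_iff)
  then show ?thesis using that by blast
qed

lemma torus_embedding_nth: "torus_embedding x $ i = tchar (axis i 1) x"
proof -
  have "lat (axis i 1) = (axis i 1 :: real ^ 'a)"
    by (auto simp: lat_def axis_def vec_eq_iff)
  then show ?thesis
    by (simp add: torus_embedding_def tchar_def inner_axis')
qed

lemma torus_embedding_periodic: "torus_embedding (x + lat v) = torus_embedding x"
  by (simp add: vec_eq_iff torus_embedding_nth tchar_periodic)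

lemma continuous_on_torus_embedding: "continuous_on S torus_embedding"
  unfolding torus_embedding_def by (intro continuous_intros)

text \<open>A real linear functional on the image of the torus is a combination of the real and
  imaginary parts of the coordinate characters, and these are combinations of a character and its
  conjugate. The remaining cases are closure under sums and products.\<close>

lemma trig_poly_real_polynomial:
  fixes p :: "complex ^ 'n \<Rightarrow> real"
  assumes "real_polynomial_function p"
  shows "trig_poly (\<lambda>x. complex_of_real (p (torus_embedding x)))"
  using assms
proof (induction p rule: real_polynomial_function.induct)
  case (linear f)
  then have lin: "linear f"
    by (simp add: bounded_linear.linear)
  have Re: "complex_of_real (Re (tchar k x)) = 1 / 2 * (tchar k x + tchar (- k) x)"
    and Im: "complex_of_real (Im (tchar k x)) = - \<i> / 2 * (tchar k x + (- 1) * tchar (- k) x)"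
    for k and x :: "real ^ 'n"
    by (simp_all add: cnj_tchar[symmetric] complex_eq_iff)
  have expand: "f z = (\<Sum>i\<in>UNIV. Re (z $ i) * f (axis i 1) + Im (z $ i) * f (axis i \<i>))" for z
  proof -
    have "z = (\<Sum>i\<in>UNIV. Re (z $ i) *\<^sub>R axis i 1 + Im (z $ i) *\<^sub>R axis i \<i>)"
      by (simp add: vec_eq_iff axis_def if_distrib sum.distrib complex_eq_iff cong: if_cong)
    then have "f z = f (\<Sum>i\<in>UNIV. Re (z $ i) *\<^sub>R axis i 1 + Im (z $ i) *\<^sub>R axis i \<i>)"
      by simp
    also have "\<dots> = (\<Sum>i\<in>UNIV. Re (z $ i) * f (axis i 1) + Im (z $ i) * f (axis i \<i>))"
      by (simp add: linear_sum[OF lin] linear_add[OF lin] linear_cmul[OF lin])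
    finally show ?thesis .
  qed
  have eq: "(\<lambda>x. complex_of_real (f (torus_embedding x))) =
     (\<lambda>x. \<Sum>i\<in>UNIV. complex_of_real (f (axis i 1)) * complex_of_real (Re (tchar (axis i 1) x)) +
        complex_of_real (f (axis i \<i>)) * complex_of_real (Im (tchar (axis i 1) x)))"
    by (subst expand) (simp add: torus_embedding_nth mult.commute)
  show ?case
    unfolding eq
  proof (rule trig_poly_sum)
    fix i :: 'n
    have pm: "trig_poly (\<lambda>x. tchar (axis i 1) x + a * tchar (- axis i 1) x)" for a
      by (rule trig_poly_add[OF trig_poly_tchar trig_poly_cmult[OF trig_poly_tchar]])
    show "trig_poly (\<lambda>x. complex_of_real (f (axis i 1)) * complex_of_real (Re (tchar (axis i 1) x)) +
        complex_of_real (f (axis i \<i>)) * complex_of_real (Im (tchar (axis i 1) x)))"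
      unfolding Re Im
      by (rule trig_poly_lin[OF trig_poly_cmult[OF pm[of 1, unfolded mult_1_left]] trig_poly_cmult[OF pm]])
  qed simp
qed (simp_all add: trig_poly_const trig_poly_add trig_poly_mult)

lemma periodic_trig_approx:
  fixes f :: "real ^ 'n \<Rightarrow> complex"
  assumes per: "\<And>x v. f (x + lat v) = f x" and cont: "continuous_on UNIV f" and "0 < e"
  obtains p where "trig_poly p" "\<And>x. norm (f x - p x) < e"
proof -
  \<comment> \<open>Transport \<open>f\<close> to the torus in \<open>\<complex>\<^sup>n\<close>, where Stone--Weierstrass applies; real polynomials restrict
    to trigonometric polynomials.\<close>
  define T :: "(complex ^ 'n) set" where "T = torus_embedding ` cbox 0 1"
  define F where "F z = f (SOME x. torus_embedding x = z)" for z
  have F: "F (torus_embedding x) = f x" for x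
  proof -
    have "torus_embedding (SOME y. torus_embedding y = torus_embedding x) = torus_embedding x"
      by (rule someI_ex) blast
    then show ?thesis
      unfolding F_def by (metis torus_embedding_eqD per)
  qed
  have inT: "torus_embedding x \<in> T" for x
    using in_unit_cube[of x] torus_embedding_periodic unfolding T_def by (metis imageI)
  have compact_image: "compact (torus_embedding ` S)" if "compact S" for S :: "(real ^ 'n) set"
    by (rule compact_continuous_image[OF continuous_on_torus_embedding that])
  have "compact T"
    unfolding T_def by (rule compact_image) simp
  \<comment> \<open>The embedding has no continuous inverse on the closed cube, whose opposite faces
    are identified. Continuity follows from closed sets: the preimage of a closed set under
    \<open>F\<close> is the image of a compact subset of the cube.\<close>
  have "continuous_on T F"
    unfolding continuous_on_closed_vimage[OF compact_imp_closed[OF \<open>compact T\<close>]]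
  proof (intro allI impI)
    fix B :: "complex set" assume "closed B"
    have "F -` B \<inter> T = torus_embedding ` (f -` B \<inter> cbox 0 1)"
      by (auto simp: T_def F)
    moreover have "compact (f -` B \<inter> cbox 0 1)"
      by (rule closed_Int_compact[OF closed_vimage[OF \<open>closed B\<close> cont]]) simp
    ultimately show "closed (F -` B \<inter> T)"
      by (simp add: compact_image compact_imp_closed)
  qed
  from Stone_Weierstrass_polynomial_function[OF \<open>compact T\<close> this \<open>0 < e\<close>]
  obtain g where g: "polynomial_function g" "\<And>z. z \<in> T \<Longrightarrow> norm (F z - g z) < e"
    by blast
  have "real_polynomial_function (\<lambda>z. Re (g z))" "real_polynomial_function (\<lambda>z. Im (g z))"
    using g(1) bounded_linear_Re bounded_linear_Im
    unfolding polynomial_function_def by (auto simp: o_def)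
  then have "trig_poly (\<lambda>x. complex_of_real (Re (g (torus_embedding x))) +
      \<i> * complex_of_real (Im (g (torus_embedding x))))"
    by (intro trig_poly_add trig_poly_cmult trig_poly_real_polynomial)
  then have "trig_poly (\<lambda>x. g (torus_embedding x))"
    by (simp flip: complex_eq)
  moreover have "norm (f x - g (torus_embedding x)) < e" for x
    using g(2)[OF inT, of x] by (simp add: F)
  ultimately show ?thesis using that by blast
qed

section \<open>Uniqueness and convergence of Fourier series\<close>

lemma tcoef_linear:
  assumes "continuous_on UNIV f" "continuous_on UNIV g"
  shows "tcoef (\<lambda>x. f x + c * g x) k = tcoef f k + c * tcoef g k"
  using tmean_linear[of "\<lambda>x. f x * tchar (- k) x" "\<lambda>x. g x * tchar (- k) x" c] assms
  by (simp add: tcoef_def ring_distribs mult.assoc continuous_on_mult continuous_on_tchar)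

text \<open>Vanishing coefficients make h orthogonal to all trigonometric polynomials. Approximating
  the conjugate of h uniformly by them shows that |h|^2 has mean zero, and a continuous nonnegative
  function with zero integral vanishes on the cube.\<close>

lemma tcoef_eq_0_imp_eq_0:
  fixes h :: "real ^ 'n \<Rightarrow> complex"
  assumes per: "\<And>x v. h (x + lat v) = h x" and cont: "continuous_on UNIV h"
    and zero: "\<And>k. tcoef h k = 0"
  shows "h x = 0"
proof -
  obtain B where B: "\<And>x. norm (h x) \<le> B"
    using periodic_bounded[OF per cont] by blast
  then have "0 \<le> B"
    using norm_ge_zero order_trans by blast
  have orth: "tmean (\<lambda>x. h x * p x) = 0" if "trig_poly p" for p
    using that
  proof (induction p rule: trig_poly.induct)
    case (trig_poly_tchar k)
    then show ?case
      using zero[of "- k"] by (simp add: tcoef_def)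
  next
    case (trig_poly_lin p q a b)
    then have "tmean (\<lambda>x. a * (h x * p x) + b * (h x * q x)) = 0"
      by (subst tmean_linear)
        (auto intro!: continuous_on_mult continuous_on_const cont intro: continuous_on_trig_poly
          simp: tmean_cmult)
    then show ?case
      by (simp add: algebra_simps)
  qed
  have le: "norm (tmean (\<lambda>x. h x * cnj (h x))) \<le> B * e" if "0 < e" for e
  proof -
    obtain p where p: "trig_poly p" "\<And>x. norm (cnj (h x) - p x) < e"
      using periodic_trig_approx[of "\<lambda>x. cnj (h x)", OF _ _ \<open>0 < e\<close>] per cont
      by (auto intro: continuous_on_cnj)
    have "tmean (\<lambda>x. h x * cnj (h x) + (- 1) * (h x * p x)) = tmean (\<lambda>x. h x * cnj (h x))"
      by (subst tmean_linear)
        (auto intro!: continuous_on_mult continuous_on_cnj cont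
          intro: continuous_on_trig_poly[OF p(1)] simp: orth[OF p(1)])
    moreover have "norm (tmean (\<lambda>x. h x * cnj (h x) + (- 1) * (h x * p x))) \<le> B * e"
    proof (rule norm_tmean_le)
      fix x
      have "h x * cnj (h x) + (- 1) * (h x * p x) = h x * (cnj (h x) - p x)"
        by (simp add: algebra_simps)
      then show "norm (h x * cnj (h x) + (- 1) * (h x * p x)) \<le> B * e"
        using mult_mono[OF B[of x] less_imp_le[OF p(2)[of x]]] \<open>0 \<le> B\<close> by (simp add: norm_mult)
    qed (intro continuous_intros cont continuous_on_trig_poly p)
    ultimately show ?thesis by simp
  qed
  have "norm (tmean (\<lambda>x. h x * cnj (h x))) \<le> 0"
  \<comment> \<open>The bound \<open>B\<close> may be 0, so the approximation is taken with
    tolerance e / (B + 1).\<close>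
  proof (rule field_le_epsilon)
    fix e :: real assume "0 < e"
    with \<open>0 \<le> B\<close> have "norm (tmean (\<lambda>x. h x * cnj (h x))) \<le> B * (e / (B + 1))"
      by (intro le) auto
    also have "\<dots> \<le> e"
      using \<open>0 \<le> B\<close> \<open>0 < e\<close> by (simp add: field_simps)
    finally show "norm (tmean (\<lambda>x. h x * cnj (h x))) \<le> 0 + e" by simp
  qed
  then have "tmean (\<lambda>x. h x * cnj (h x)) = 0" by simp
  moreover have "((\<lambda>x. h x * cnj (h x)) has_integral tmean (\<lambda>x. h x * cnj (h x))) (cbox 0 1)"
    unfolding tmean_def
    by (intro integrable_integral cont_integrable continuous_intros cont)
  ultimately have "((\<lambda>x. Re (h x * cnj (h x))) has_integral Re 0) (cbox 0 1)"
    by (metis has_integral_Re)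
  then have int0: "((\<lambda>x. (norm (h x))\<^sup>2) has_integral 0) (cbox 0 1)"
    by (simp add: complex_mult_cnj cmod_power2)
  obtain v where v: "x + lat v \<in> cbox 0 1"
    using in_unit_cube by blast
  have "(norm (h (x + lat v)))\<^sup>2 = 0"
  proof (rule has_integral_0_cbox_imp_0[OF _ _ int0 _ v])
    show "continuous_on (cbox 0 1) (\<lambda>x. (norm (h x))\<^sup>2)"
      by (intro continuous_intros continuous_on_subset[OF cont]) auto
    show "box 0 (1 :: real ^ 'n) \<noteq> {}"
      by (simp add: interval_ne_empty_cart)
  qed auto
  then show ?thesis by (simp add: per)
qed

text \<open>Decay of order 2n suffices, because that power of the bracket is summable over the
  lattice.\<close>

lemma tcoef_abs_summable:
  fixes f :: "real ^ 'n \<Rightarrow> complex"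
  assumes f: "f \<in> test_funs"
  obtains M where "\<And>k. norm (tcoef f k) \<le> M k" "M summable_on UNIV"
proof -
  define D where "D = (1 + real CARD('n)) ^ (2 * CARD('n)) * Cm_norm (2 * CARD('n)) f"
  have "norm (tcoef f k) \<le> D * (1 / bracket k ^ (2 * CARD('n)))" for k
    using tcoef_decay[OF f, of k "2 * CARD('n)"] by (simp add: D_def field_simps)
  moreover have "(\<lambda>k :: int ^ 'n. D * (1 / bracket k ^ (2 * CARD('n)))) summable_on UNIV"
    by (rule summable_on_cmult_right[OF summable_on_bracket_power])
  ultimately show ?thesis by (rule that)
qed

text \<open>The M-test gives some continuous periodic limit \<open>S\<close>. Coefficients pass to
  uniform limits, so \<open>S\<close> has the coefficients of f, and uniqueness identifies the
  two.\<close>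

lemma fourier_uniform_limit:
  fixes f :: "real ^ 'n \<Rightarrow> complex"
  assumes f: "f \<in> test_funs"
  shows "uniform_limit UNIV (\<lambda>F x. \<Sum>k\<in>F. tcoef f k * tchar k x) f (finite_subsets_at_top UNIV)"
proof -
  define S where "S x = (\<Sum>\<^sub>\<infinity>k. tcoef f k * tchar k x)" for x
  obtain M where M: "\<And>k. norm (tcoef f k) \<le> M k" "M summable_on UNIV"
    using tcoef_abs_summable[OF f] by blast
  have lim: "uniform_limit UNIV (\<lambda>F x. \<Sum>k\<in>F. tcoef f k * tchar k x) S (finite_subsets_at_top UNIV)"
    unfolding S_def by (rule Weierstrass_m_test_general[OF _ M(2)]) (simp add: norm_mult M(1))
  have contF: "continuous_on UNIV (\<lambda>x. \<Sum>k\<in>F. tcoef f k * tchar k x)" for F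
    by (intro continuous_intros)
  have contS: "continuous_on UNIV S"
    by (rule uniform_limit_theorem[OF _ lim]) (auto simp: contF)
  have cf: "continuous_on UNIV f"
    by (rule continuous_on_test_funs[OF f])
  have coef: "tcoef S j = tcoef f j" for j
  proof -
    have "((\<lambda>F. tcoef (\<lambda>x. \<Sum>k\<in>F. tcoef f k * tchar k x) j) \<longlongrightarrow> tcoef S j) (finite_subsets_at_top UNIV)"
    proof (rule tendstoI)
      fix e :: real assume "0 < e"
      then have "\<forall>\<^sub>F F in finite_subsets_at_top UNIV.
          \<forall>x\<in>UNIV. dist (\<Sum>k\<in>F. tcoef f k * tchar k x) (S x) < e / 2"
        using lim by (intro uniform_limitD) auto
      then show "\<forall>\<^sub>F F in finite_subsets_at_top UNIV.
          dist (tcoef (\<lambda>x. \<Sum>k\<in>F. tcoef f k * tchar k x) j) (tcoef S j) < e"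
      proof eventually_elim
        case (elim F)
        have "tcoef (\<lambda>x. \<Sum>k\<in>F. tcoef f k * tchar k x) j - tcoef S j =
            tcoef (\<lambda>x. (\<Sum>k\<in>F. tcoef f k * tchar k x) - S x) j"
          using tcoef_linear[OF contF contS, of F "- 1"] by simp
        moreover have "norm (tcoef (\<lambda>x. (\<Sum>k\<in>F. tcoef f k * tchar k x) - S x) j) \<le> e / 2"
          by (rule norm_tcoef_le)
            (use elim in \<open>auto intro!: continuous_on_diff contF contS simp: dist_norm less_imp_le\<close>)
        ultimately show ?case
          using \<open>0 < e\<close> by (simp add: dist_norm)
      qed
    qed
    moreover have "((\<lambda>F. tcoef (\<lambda>x. \<Sum>k\<in>F. tcoef f k * tchar k x) j) \<longlongrightarrow> tcoef f j) (finite_subsets_at_top UNIV)"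
    \<comment> \<open>By orthogonality the coefficient at j no longer changes once the partial sum
      contains j.\<close>
    proof (rule tendsto_eventually)
      have "tcoef (\<lambda>x. \<Sum>k\<in>F. tcoef f k * tchar k x) j = tcoef f j" if "finite F" "{j} \<subseteq> F" for F
      proof -
        have "tcoef (\<lambda>x. \<Sum>k\<in>F. tcoef f k * tchar k x) j =
            tmean (\<lambda>x. \<Sum>k\<in>F. tcoef f k * tchar (k - j) x)"
          by (simp add: tcoef_def sum_distrib_right mult.assoc tchar_mult)
        also have "\<dots> = (\<Sum>k\<in>F. tcoef f k * (if k = j then 1 else 0))"
          by (subst tmean_sum) (auto simp: that tmean_tchar intro: continuous_on_tchar)
        also have "\<dots> = tcoef f j"
          using that by (simp add: if_distrib cong: if_cong)
        finally show ?thesis .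
      qed
      then show "\<forall>\<^sub>F F in finite_subsets_at_top UNIV.
          tcoef (\<lambda>x. \<Sum>k\<in>F. tcoef f k * tchar k x) j = tcoef f j"
        unfolding eventually_finite_subsets_at_top by (intro exI[of _ "{j}"]) auto
    qed
    ultimately show ?thesis
      by (rule tendsto_unique[OF finite_subsets_at_top_neq_bot])
  qed
  have "S x - f x = 0" for x
  proof (rule tcoef_eq_0_imp_eq_0[of "\<lambda>x. S x - f x"])
    show "tcoef (\<lambda>x. S x - f x) k = 0" for k
      using tcoef_linear[OF contS cf, of "- 1"] coef[of k] by simp
  qed (auto simp: S_def tchar_periodic test_funs_periodic[OF f] contS[unfolded S_def[abs_def]] cf
      intro!: continuous_on_diff)
  then have "S = f" by (simp add: fun_eq_iff)
  with lim show ?thesis by simp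
qed

section \<open>Distributions as polynomially bounded coefficient families\<close>

lemma distributions_add:
  "u \<in> distributions \<Longrightarrow> f \<in> test_funs \<Longrightarrow> g \<in> test_funs \<Longrightarrow> u (\<lambda>x. f x + g x) = u f + u g"
  by (simp add: distributions_def)

lemma distributions_cmult:
  "u \<in> distributions \<Longrightarrow> f \<in> test_funs \<Longrightarrow> u (\<lambda>x. c * f x) = c * u f"
  by (simp add: distributions_def)

lemma distributions_sum:
  assumes u: "u \<in> distributions" and "finite F" and "\<And>k. k \<in> F \<Longrightarrow> f k \<in> test_funs"
  shows "u (\<lambda>x. \<Sum>k\<in>F. c k * f k x) = (\<Sum>k\<in>F. c k * u (f k))"
  using assms(2,3)
proof (induction F rule: finite_induct)
  case empty
  show ?case
    using distributions_cmult[OF u zero_test_funs, of 0] by simp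
next
  case (insert k F)
  then show ?case
    by (simp add: distributions_add[OF u cmult_test_funs sum_test_funs] distributions_cmult[OF u])
qed

lemma distribution_fourier_has_sum:
  fixes f :: "real ^ 'n \<Rightarrow> complex"
  assumes u: "u \<in> distributions" and f: "f \<in> test_funs"
  shows "((\<lambda>k. tcoef f k * fcoeff u (- k)) has_sum u f) UNIV"
proof -
  obtain m C where C: "\<And>\<phi>. \<phi> \<in> test_funs \<Longrightarrow> cmod (u \<phi>) \<le> C * Cm_norm m \<phi>"
    using u unfolding distributions_def by blast
  define L where "L = real (card {js :: 'n list. length js \<le> m})"
  define S where "S F x = (\<Sum>k\<in>F. tcoef f k * tchar k x)" for F x
  have S: "S F \<in> test_funs" if "finite F" for F
    unfolding S_def[abs_def] by (rule sum_test_funs[OF that tchar_test_funs])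
  \<comment> \<open>Derivatives of the Fourier partial sums are Fourier partial sums of the derivatives, so uniform
    convergence for every test function already gives convergence in each \<^const>\<open>Cm_norm\<close>.\<close>
  have part: "partials js (S F) x = (\<Sum>k\<in>F. tcoef (partials js f) k * tchar k x)" if "finite F" for js F x
    unfolding S_def[abs_def] partials_sum[OF that tchar_test_funs]
    by (simp add: partials_tchar tcoef_partials[OF f] mult_ac)
  show ?thesis
    unfolding has_sum_def
  proof (rule tendstoI)
    fix e :: real assume "0 < e"
    \<comment> \<open>\<open>L\<close> counts the multi-indices, so closeness \<open>d\<close> of
      all derivatives up to order m costs at most |C| L d under \<open>u\<close>. The added 1 makes
      this strictly smaller than e and keeps the denominator positive.\<close>
    define d where "d = e / (\<bar>C\<bar> * L + 1)"
    have pos: "0 < \<bar>C\<bar> * L + 1"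
      by (simp add: L_def add_nonneg_pos)
    then have "0 < d" using \<open>0 < e\<close> by (simp add: d_def)
    have "\<forall>\<^sub>F F in finite_subsets_at_top UNIV. \<forall>x\<in>UNIV.
        dist (\<Sum>k\<in>F. tcoef (partials js f) k * tchar k x) (partials js f x) < d" for js
      by (rule uniform_limitD[OF fourier_uniform_limit[OF partials_test_funs[OF f]] \<open>0 < d\<close>])
    then have "\<forall>\<^sub>F F in finite_subsets_at_top UNIV. \<forall>js\<in>{js. length js \<le> m}. \<forall>x\<in>UNIV.
        dist (\<Sum>k\<in>F. tcoef (partials js f) k * tchar k x) (partials js f x) < d"
      by (intro eventually_ball_finite finite_short_lists) auto
    moreover have "\<forall>\<^sub>F F in finite_subsets_at_top (UNIV :: (int ^ 'n) set). finite F"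
      by (rule eventually_finite_subsets_at_top_weakI)
    ultimately show "\<forall>\<^sub>F F in finite_subsets_at_top UNIV.
        dist (\<Sum>k\<in>F. tcoef f k * fcoeff u (- k)) (u f) < e"
    proof eventually_elim
      case (elim F)
      have diff: "(\<lambda>x. S F x + (- 1) * f x) \<in> test_funs"
        by (rule test_funs_linear[OF S[OF elim(2)] f])
      have "Cm_norm m (\<lambda>x. S F x + (- 1) * f x) \<le> L * d"
        unfolding L_def
      proof (rule Cm_norm_le)
        fix js :: "'n list" and x assume "length js \<le> m"
        then show "norm (partials js (\<lambda>x. S F x + (- 1) * f x) x) \<le> d"
          using elim(1) unfolding partials_linear[OF S[OF elim(2)] f]
          by (simp add: part[OF elim(2)] dist_norm less_imp_le)
      qed
      moreover have "0 \<le> Cm_norm m (\<lambda>x. S F x + (- 1) * f x)"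
        by (rule order_trans[OF norm_ge_zero norm_partials_le_Cm_norm[OF diff, of "[]"]]) simp
      ultimately have "C * Cm_norm m (\<lambda>x. S F x + (- 1) * f x) \<le> \<bar>C\<bar> * (L * d)"
        by (intro mult_mono) auto
      then have "norm (u (\<lambda>x. S F x + (- 1) * f x)) \<le> \<bar>C\<bar> * L * d"
        using C[OF diff] by simp
      also have "\<dots> < e"
        using pos \<open>0 < e\<close> by (simp add: d_def field_simps)
      finally have less: "norm (u (\<lambda>x. S F x + (- 1) * f x)) < e" .
      have "u (\<lambda>x. S F x + (- 1) * f x) = u (S F) - u f"
        using distributions_add[OF u S[OF elim(2)] cmult_test_funs[OF f, of "- 1"]]
          distributions_cmult[OF u f, of "- 1"] by simp
      moreover have "u (S F) = (\<Sum>k\<in>F. tcoef f k * fcoeff u (- k))"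
        unfolding S_def[abs_def] fcoeff_eq
        by (simp add: distributions_sum[OF u elim(2) tchar_test_funs])
      ultimately show ?case
        using less by (simp add: dist_norm)
    qed
  qed
qed

text \<open>The Fourier expansion fixes the values on test functions; extensionality takes care of
  all other arguments.\<close>

lemma distributions_eqI:
  assumes "u \<in> distributions" "v \<in> distributions" "\<And>k. fcoeff u k = fcoeff v k"
  shows "u = v"
proof (rule extensionalityI)
  show "u \<in> extensional test_funs" "v \<in> extensional test_funs"
    using assms by (auto simp: distributions_def)
  show "u f = v f" if "f \<in> test_funs" for f
    using distribution_fourier_has_sum[OF assms(1) that] distribution_fourier_has_sum[OF assms(2) that]
    by (simp add: assms(3) has_sum_unique)
qed

text \<open>Define u by summing c(k) against the coefficient of the test function at -k. Decay of
  order \<open>Q\<close> absorbs the growth of c and leaves the summable power -2n of the bracket.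
  The same estimate gives continuity with respect to \<open>Cm_norm Q\<close>. At a character only
  one term survives.\<close>

lemma distribution_exists:
  fixes c :: "int ^ 'n \<Rightarrow> complex"
  assumes c: "\<And>k. norm (c k) \<le> B * bracket k ^ N"
  obtains u where "u \<in> distributions" "\<And>k. fcoeff u k = c k"
proof -
  define Q where "Q = N + 2 * CARD('n)"
  define K where "K = \<bar>B\<bar> * (1 + real CARD('n)) ^ Q"
  have bound: "norm (c k * tcoef f (- k)) \<le> K * Cm_norm Q f * (1 / bracket k ^ (2 * CARD('n)))"
    if f: "f \<in> test_funs" for f k
  proof -
    have "norm (c k) \<le> \<bar>B\<bar> * bracket k ^ N"
      by (rule order_trans[OF c]) (simp add: mult_right_mono less_imp_le)
    then have "norm (c k * tcoef f (- k)) \<le> \<bar>B\<bar> * bracket k ^ N * norm (tcoef f (- k))"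
      unfolding norm_mult by (rule mult_right_mono) simp
    also have "\<dots> = \<bar>B\<bar> * (bracket k ^ Q * norm (tcoef f (- k))) * (1 / bracket k ^ (2 * CARD('n)))"
      by (simp add: Q_def power_add less_imp_neq[OF bracket_pos, symmetric])
    also have "\<dots> \<le> \<bar>B\<bar> * ((1 + real CARD('n)) ^ Q * Cm_norm Q f) * (1 / bracket k ^ (2 * CARD('n)))"
      using tcoef_decay[OF f, of "- k" Q]
      by (intro mult_right_mono mult_left_mono) (auto simp: less_imp_le)
    finally show ?thesis
      by (simp add: K_def mult_ac)
  qed
  have major: "(\<lambda>k :: int ^ 'n. K * Cm_norm Q f * (1 / bracket k ^ (2 * CARD('n)))) summable_on UNIV" for f
    by (rule summable_on_cmult_right[OF summable_on_bracket_power])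
  have summ: "(\<lambda>k. c k * tcoef f (- k)) summable_on UNIV" if "f \<in> test_funs" for f
    by (rule abs_summable_summable, rule summable_on_comparison_test[OF major[of f]])
      (use bound[OF that] in auto)
  define u where "u = (\<lambda>f\<in>test_funs. \<Sum>\<^sub>\<infinity>k. c k * tcoef f (- k))"
  have u: "u f = (\<Sum>\<^sub>\<infinity>k. c k * tcoef f (- k))" if "f \<in> test_funs" for f
    using that by (simp add: u_def)
  have lin: "u (\<lambda>x. f x + a * g x) = u f + a * u g" if fg: "f \<in> test_funs" "g \<in> test_funs" for f g a
  proof -
    have "u (\<lambda>x. f x + a * g x) = (\<Sum>\<^sub>\<infinity>k. c k * tcoef f (- k) + a * (c k * tcoef g (- k)))"
      unfolding u[OF test_funs_linear[OF fg]]
      by (simp add: tcoef_linear continuous_on_test_funs fg algebra_simps)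
    also have "\<dots> = u f + a * u g"
      unfolding u[OF fg(1)] u[OF fg(2)]
      by (subst infsum_add) (auto simp: summ fg summable_on_cmult_right infsum_cmult_right)
    finally show ?thesis .
  qed
  have "u \<in> distributions"
    unfolding distributions_def mem_Collect_eq
  proof (intro conjI ballI allI)
    show "u \<in> extensional test_funs" by (simp add: u_def)
    show "u (\<lambda>x. f x + g x) = u f + u g" if "f \<in> test_funs" "g \<in> test_funs" for f g
      using lin[OF that, of 1] by simp
    show "u (\<lambda>x. a * f x) = a * u f" if f: "f \<in> test_funs" for f a
    proof -
      have "u (\<lambda>x. 0) = 0"
        using lin[OF f f, of "- 1"] by simp
      then show ?thesis
        using lin[OF zero_test_funs f, of a] by simp
    qed
    show "\<exists>m C. \<forall>\<phi>\<in>test_funs. cmod (u \<phi>) \<le> C * Cm_norm m \<phi>"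
    proof (intro exI ballI)
      fix f :: "real ^ 'n \<Rightarrow> complex" assume f: "f \<in> test_funs"
      have "norm (u f) \<le> (\<Sum>\<^sub>\<infinity>k :: int ^ 'n. K * Cm_norm Q f * (1 / bracket k ^ (2 * CARD('n))))"
        unfolding u[OF f]
        by (rule norm_infsum_le[OF has_sum_infsum[OF summ[OF f]] has_sum_infsum[OF major] bound[OF f]])
      also have "\<dots> = (K * (\<Sum>\<^sub>\<infinity>k :: int ^ 'n. 1 / bracket k ^ (2 * CARD('n)))) * Cm_norm Q f"
        by (subst infsum_cmult_right[OF summable_on_bracket_power]) simp
      finally show "norm (u f) \<le> (K * (\<Sum>\<^sub>\<infinity>k :: int ^ 'n. 1 / bracket k ^ (2 * CARD('n)))) * Cm_norm Q f" .
    qed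
  qed
  moreover have "fcoeff u k = c k" for k
  proof -
    have "fcoeff u k = (\<Sum>\<^sub>\<infinity>j. c j * (if - k = - j then 1 else 0))"
      unfolding fcoeff_eq u[OF tchar_test_funs] tcoef_tchar ..
    also have "\<dots> = (\<Sum>\<^sub>\<infinity>j\<in>{k}. c j)"
      by (rule infsum_cong_neutral) auto
    finally show ?thesis by simp
  qed
  ultimately show ?thesis using that by blast
qed

section \<open>Radon transform of characters\<close>

lemma inj_lat: "inj (lat :: int ^ 'n \<Rightarrow> rat ^ 'n)"
  by (auto simp: inj_def lat_def vec_eq_iff)

lemma rat_vector_clear_denominators:
  fixes v :: "rat ^ 'n"
  obtains m :: rat where "m \<noteq> 0" "m *s v \<in> range lat"
proof -
  define q where "q i = snd (quotient_of (v $ i))" for i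
  define p where "p i = fst (quotient_of (v $ i))" for i
  have q: "q i > 0" "v $ i = of_int (p i) / of_int (q i)" for i
    by (auto simp: p_def q_def quotient_of_denom_pos' quotient_of_div)
  define m where "m = (\<Prod>i\<in>UNIV. q i)"
  have "of_int m * v $ i = (of_int (p i * prod q (UNIV - {i})) :: rat)" for i
  proof -
    have "m = q i * prod q (UNIV - {i})"
      unfolding m_def by (rule prod.remove) auto
    then show ?thesis
      using q[of i] by simp
  qed
  then have "of_int m *s v = lat (\<chi> i. p i * prod q (UNIV - {i}))"
    by (simp add: vec_eq_iff lat_def)
  moreover have "m > 0"
    unfolding m_def using q by (intro prod_pos) auto
  ultimately show ?thesis
    using that[of "of_int m"] by auto
qed

text \<open>Justifies the choice in the definition: a maximal independent set of lattice vectors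
  inside A spans A, since clearing denominators moves every vector of A to a lattice vector on the
  same line.\<close>

lemma int_basis:
  fixes A :: "(rat ^ 'n) set"
  assumes A: "vec.subspace A"
  shows "finite (int_basis A) \<and> vec.independent (lat ` int_basis A :: (rat ^ 'n) set) \<and>
    vec.span (lat ` int_basis A) = A"
  unfolding int_basis_def
proof (rule someI_ex)
  obtain B where B: "B \<subseteq> A \<inter> range lat" "vec.independent B" "A \<inter> range lat \<subseteq> vec.span B"
    using vec.basis_exists by metis
  have "vec.span B = A"
  proof
    show "vec.span B \<subseteq> A"
      using B(1) A by (intro vec.span_minimal) auto
    show "A \<subseteq> vec.span B"
    proof
      fix v assume "v \<in> A"
      obtain m where m: "m \<noteq> 0" "m *s v \<in> range lat"
        by (rule rat_vector_clear_denominators)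
      have "m *s v \<in> vec.span B"
        using B(3) m(2) vec.subspace_scale[OF A \<open>v \<in> A\<close>] by blast
      then have "(1 / m) *s (m *s v) \<in> vec.span B"
        by (rule vec.span_scale)
      then show "v \<in> vec.span B"
        using m(1) by (simp add: vector_smult_assoc)
    qed
  qed
  moreover have "lat ` (lat -` B :: (int ^ 'n) set) = B"
    using B(1) by blast
  moreover have "finite (lat -` B :: (int ^ 'n) set)"
    using vec.finiteI_independent[OF B(2)] inj_lat by (intro finite_vimageI)
  ultimately show "\<exists>B :: (int ^ 'n) set. finite B \<and> vec.independent (lat ` B :: (rat ^ 'n) set) \<and>
      vec.span (lat ` B) = A"
    using B(2) by metis
qed

text \<open>The vectors orthogonal to k form a subspace \<open>K\<close>, so orthogonality to A can
  be tested on a spanning set.\<close>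

lemma perp_iff_int_basis:
  fixes A :: "(rat ^ 'n) set"
  assumes A: "vec.subspace A"
  shows "perp k A \<longleftrightarrow> (\<forall>v\<in>int_basis A. (\<Sum>i\<in>UNIV. k $ i * v $ i) = 0)"
proof -
  define K :: "(rat ^ 'n) set" where "K = {v. (\<Sum>i\<in>UNIV. of_int (k $ i) * v $ i) = 0}"
  have K: "vec.subspace K"
    unfolding K_def vec.subspace_def
    by (auto simp: ring_distribs sum.distrib mult.left_commute[of "of_int _"] simp flip: sum_distrib_left)
  have lat: "lat v \<in> K \<longleftrightarrow> (\<Sum>i\<in>UNIV. k $ i * v $ i) = 0" for v
  proof -
    have "(\<Sum>i\<in>UNIV. of_int (k $ i) * (lat v :: rat ^ 'n) $ i) = of_int (\<Sum>i\<in>UNIV. k $ i * v $ i)"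
      by (simp add: lat_def)
    then show ?thesis
      by (simp add: K_def del: of_int_sum)
  qed
  have "perp k A \<longleftrightarrow> A \<subseteq> K"
    by (auto simp: perp_def K_def)
  also have "\<dots> \<longleftrightarrow> vec.span (lat ` int_basis A) \<subseteq> K"
    using int_basis[OF A] by simp
  also have "\<dots> \<longleftrightarrow> lat ` int_basis A \<subseteq> K"
    using vec.span_minimal[OF _ K, of "lat ` int_basis A"] vec.span_superset[of "lat ` int_basis A"]
    by auto
  also have "\<dots> \<longleftrightarrow> (\<forall>v\<in>int_basis A. (\<Sum>i\<in>UNIV. k $ i * v $ i) = 0)"
    by (auto simp: lat)
  finally show ?thesis .
qed

lemma integral_cis:
  fixes m :: int
  shows "(LINT t|lborel. indicator {0..1} t *\<^sub>R cis (2 * pi * (of_int m * t))) = (if m = 0 then 1 else 0)"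
proof (cases "m = 0")
  case True
  then show ?thesis by simp
next
  case False
  define F where "F t = cis (2 * pi * (of_int m * t)) / (2 * pi * \<i> * of_int m)" for t
  have "(LINT t|lborel. indicator {0..1} t *\<^sub>R cis (2 * pi * (of_int m * t))) = F 1 - F 0"
  proof (rule integral_FTC_Icc)
    fix t :: real
    have "((\<lambda>t. cis (2 * pi * (of_int m * t))) has_vector_derivative
        (2 * pi * of_int m) *\<^sub>R (\<i> * cis (2 * pi * (of_int m * t)))) (at t within {0..1})"
      unfolding has_vector_derivative_def
      by (rule derivative_eq_intros refl)+ (simp add: scaleR_conv_of_real mult_ac)
    then have "(F has_vector_derivative
        (2 * pi * of_int m) *\<^sub>R (\<i> * cis (2 * pi * (of_int m * t))) / (2 * pi * \<i> * of_int m))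
        (at t within {0..1})"
      unfolding F_def[abs_def] by (rule has_vector_derivative_divide)
    then show "(F has_vector_derivative cis (2 * pi * (of_int m * t))) (at t within {0..1})"
      using False by (simp add: scaleR_conv_of_real)
  qed (auto intro!: continuous_intros)
  also have "\<dots> = 0"
    using cis_multiple_2pi[of "of_int m"] by (simp add: F_def)
  finally show ?thesis using False by simp
qed

lemma integrable_cis:
  "integrable lborel (\<lambda>t. indicator {0..1::real} t *\<^sub>R cis (2 * pi * (m * t)))"
proof -
  have "continuous_on {0..1} (\<lambda>t. cis (2 * pi * (m * t)))"
    by (intro continuous_intros)
  then show ?thesis
    using borel_integrable_atLeastAtMost' unfolding set_integrable_def by blast
qed

lemma tchar_sum: "finite B \<Longrightarrow> tchar k (\<Sum>v\<in>B. f v) = (\<Prod>v\<in>B. tchar k (f v))"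
proof (induction B rule: finite_induct)
  case empty
  show ?case by (simp add: tchar_def)
qed (simp add: tchar_add)

text \<open>A character turns the sum over the directions into a product of functions of one
  variable each, so the integral over the cube splits into one-dimensional integrals over periods of
  integer frequency.\<close>

lemma radon_fun_tchar:
  fixes B :: "(int ^ 'n) set"
  assumes B: "finite B"
  shows "radon_fun B (tchar k) x = (if \<forall>v\<in>B. (\<Sum>i\<in>UNIV. k $ i * v $ i) = 0 then tchar k x else 0)"
proof -
  interpret product_sigma_finite "\<lambda>v :: int ^ 'n. lborel :: real measure"
    by standard
  define m where "m v = (\<Sum>i\<in>UNIV. k $ i * v $ i)" for v :: "int ^ 'n"
  define \<phi> where "\<phi> v t = indicator {0..1} t *\<^sub>R cis (2 * pi * (of_int (m v) * t))" for v and t :: real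
  have char: "tchar k (t *\<^sub>R lat v) = cis (2 * pi * (of_int (m v) * t))" for v t
    by (simp add: tchar_def lat_inner_lat m_def mult_ac)
  have "radon_fun B (tchar k) x = (LINT t|(\<Pi>\<^sub>M v\<in>B. lborel). tchar k x * (\<Prod>v\<in>B. \<phi> v (t v)))"
    unfolding radon_fun_def set_lebesgue_integral_def
  proof (rule Bochner_Integration.integral_cong[OF refl])
    fix t :: "int ^ 'n \<Rightarrow> real" assume "t \<in> space (\<Pi>\<^sub>M v\<in>B. lborel)"
    \<comment> \<open>Points of the product space are extensional on \<open>B\<close>, so membership
      in the cube is a condition on the coordinates alone.\<close>
    then have ext: "t \<in> extensional B"
      by (auto simp: space_PiM PiE_def)
    show "indicator (\<Pi>\<^sub>E v\<in>B. {0..1}) t *\<^sub>R tchar k (x + (\<Sum>v\<in>B. t v *\<^sub>R lat v)) =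
        tchar k x * (\<Prod>v\<in>B. \<phi> v (t v))"
    proof (cases "\<forall>v\<in>B. t v \<in> {0..1}")
      case True
      then have "t \<in> (\<Pi>\<^sub>E v\<in>B. {0..1})"
        using ext by (auto simp: PiE_iff)
      then show ?thesis
        using True by (simp add: tchar_add tchar_sum[OF B] char \<phi>_def)
    next
      case False
      then obtain v where "v \<in> B" "t v \<notin> {0..1}" by blast
      then have "t \<notin> (\<Pi>\<^sub>E v\<in>B. {0..1})" "\<phi> v (t v) = 0"
        by (auto simp: \<phi>_def PiE_iff)
      then show ?thesis
        using \<open>v \<in> B\<close> B by (auto simp: prod_zero_iff)
    qed
  qed
  also have "\<dots> = tchar k x * (\<Prod>v\<in>B. LINT t|lborel. \<phi> v t)"
    by (subst integral_mult_right_zero, subst product_integral_prod[OF B])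
      (auto simp: \<phi>_def[abs_def] integrable_cis)
  also have "\<dots> = tchar k x * (\<Prod>v\<in>B. if m v = 0 then 1 else 0)"
    by (simp add: \<phi>_def integral_cis)
  also have "\<dots> = (if \<forall>v\<in>B. m v = 0 then tchar k x else 0)"
    using B by (auto simp: prod_zero_iff)
  finally show ?thesis by (simp add: m_def)
qed

lemma perp_minus: "perp (- k) A \<longleftrightarrow> perp k A"
  by (simp add: perp_def sum_negf)

text \<open>The data norm and inner product see the transform only through its coefficients, so this
  is the link between integrals along A and the mode sums. The chosen basis has disappeared from the
  right-hand side.\<close>

lemma fcoeff_radon:
  assumes u: "u \<in> distributions" and A: "A \<in> Gr d"
  shows "fcoeff (radon u A) k = (if perp k A then fcoeff u k else 0)"
proof -
  have sub: "vec.subspace A" using A by (simp add: Gr_def)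
  have "radon_fun (int_basis A) (tchar (- k)) = (if perp k A then tchar (- k) else (\<lambda>x. 0))"
    using int_basis[OF sub] perp_iff_int_basis[OF sub, of "- k"]
    by (simp add: fun_eq_iff radon_fun_tchar perp_minus)
  moreover have "u (\<lambda>x. 0) = 0"
    using distributions_cmult[OF u zero_test_funs, of 0] by simp
  ultimately show ?thesis
    by (simp add: fcoeff_eq radon_def tchar_test_funs)
qed

lemma fcoeff_minus_distr: "fcoeff (minus_distr u v) k = fcoeff u k - fcoeff v k"
  by (simp add: fcoeff_eq minus_distr_def tchar_test_funs)

section \<open>Extended nonnegative sums and multipliers\<close>

lemma summable_ennreal: "f summable_on A" for f :: "'a \<Rightarrow> ennreal"
  by (rule nonneg_summable_on_complete) simp

lemma ennreal_infsum:
  assumes "f summable_on A" "\<And>x. x \<in> A \<Longrightarrow> 0 \<le> f x"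
  shows "(\<Sum>\<^sub>\<infinity>x\<in>A. ennreal (f x)) = ennreal (infsum f A)"
proof -
  have "(\<Sum>\<^sub>\<infinity>x\<in>A. ennreal (f x)) = (SUP F\<in>{F. finite F \<and> F \<subseteq> A}. \<Sum>x\<in>F. ennreal (f x))"
    by (rule nonneg_infsum_complete) simp
  also have "\<dots> = (SUP F\<in>{F. finite F \<and> F \<subseteq> A}. ennreal (sum f F))"
    using assms(2) by (intro SUP_cong refl sum_ennreal) auto
  also have "\<dots> = ennreal (infsum f A)"
    by (rule infsum_nonneg_is_SUPREMUM_ennreal[symmetric]) (use assms in auto)
  finally show ?thesis .
qed

lemma finite_sum_le_infsum_ennreal:
  fixes f :: "'a \<Rightarrow> ennreal"
  assumes "finite F" "F \<subseteq> A"
  shows "sum f F \<le> infsum f A"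
  by (subst nonneg_infsum_complete) (use assms in \<open>auto intro: SUP_upper\<close>)

lemma member_le_infsum_ennreal:
  fixes f :: "'a \<Rightarrow> ennreal"
  shows "x \<in> A \<Longrightarrow> f x \<le> infsum f A"
  using finite_sum_le_infsum_ennreal[of "{x}" A f] by simp

text \<open>The way back from sums in [0,\<infinity>] to real series: a finite total bounds all
  partial sums.\<close>

lemma summable_on_of_ennreal:
  assumes fin: "(\<Sum>\<^sub>\<infinity>x\<in>A. ennreal (f x)) < top" and nonneg: "\<And>x. x \<in> A \<Longrightarrow> 0 \<le> f x"
  shows "f summable_on A"
proof (rule nonneg_bounded_partial_sums_imp_summable_on)
  let ?S = "\<Sum>\<^sub>\<infinity>x\<in>A. ennreal (f x)"
  have "sum f F \<le> enn2real ?S" if "finite F" "F \<subseteq> A" for F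
  proof -
    have "ennreal (sum f F) = (\<Sum>x\<in>F. ennreal (f x))"
      using that nonneg by (intro sum_ennreal[symmetric]) auto
    also have "\<dots> \<le> ?S"
      using that by (rule finite_sum_le_infsum_ennreal)
    finally show ?thesis
      using fin nonneg that by (metis enn2real_ennreal enn2real_mono subsetD sum_nonneg)
  qed
  then show "\<forall>\<^sub>F F in finite_subsets_at_top A. sum f F \<le> enn2real ?S"
    by (intro eventually_finite_subsets_at_top_weakI)
qed (rule nonneg)

lemma infsum_sum_ennreal:
  fixes f :: "'a \<Rightarrow> 'b \<Rightarrow> ennreal"
  assumes "finite F"
  shows "(\<Sum>\<^sub>\<infinity>y\<in>B. \<Sum>x\<in>F. f x y) = (\<Sum>x\<in>F. \<Sum>\<^sub>\<infinity>y\<in>B. f x y)"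
  using assms
proof (induction F rule: finite_induct)
  case (insert x F)
  then show ?case
    by (simp add: infsum_add[OF summable_ennreal summable_ennreal])
qed simp

text \<open>Tonelli for arbitrary index sets: a sum in [0,\<infinity>] is the supremum of its finite
  partial sums, and finite sums commute with infinite ones. This gives one inequality, and by
  symmetry the other.\<close>

lemma infsum_swap_ennreal:
  fixes f :: "'a \<Rightarrow> 'b \<Rightarrow> ennreal"
  shows "(\<Sum>\<^sub>\<infinity>x\<in>A. \<Sum>\<^sub>\<infinity>y\<in>B. f x y) = (\<Sum>\<^sub>\<infinity>y\<in>B. \<Sum>\<^sub>\<infinity>x\<in>A. f x y)"
proof -
  have le: "(\<Sum>\<^sub>\<infinity>x\<in>X. \<Sum>\<^sub>\<infinity>y\<in>Y. h x y) \<le> (\<Sum>\<^sub>\<infinity>y\<in>Y. \<Sum>\<^sub>\<infinity>x\<in>X. h x y)"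
    for X Y and h :: "'c \<Rightarrow> 'd \<Rightarrow> ennreal"
  proof (subst nonneg_infsum_complete[of X], simp, rule SUP_least)
    fix F assume F: "F \<in> {F. finite F \<and> F \<subseteq> X}"
    then have "(\<Sum>x\<in>F. \<Sum>\<^sub>\<infinity>y\<in>Y. h x y) = (\<Sum>\<^sub>\<infinity>y\<in>Y. \<Sum>x\<in>F. h x y)"
      by (simp add: infsum_sum_ennreal)
    also have "\<dots> \<le> (\<Sum>\<^sub>\<infinity>y\<in>Y. \<Sum>\<^sub>\<infinity>x\<in>X. h x y)"
      using F by (intro infsum_mono summable_ennreal finite_sum_le_infsum_ennreal) auto
    finally show "(\<Sum>x\<in>F. \<Sum>\<^sub>\<infinity>y\<in>Y. h x y) \<le> (\<Sum>\<^sub>\<infinity>y\<in>Y. \<Sum>\<^sub>\<infinity>x\<in>X. h x y)" .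
  qed
  show ?thesis
    by (rule antisym[OF le le])
qed

lemma infsum_cmult_ennreal:
  fixes f :: "'a \<Rightarrow> ennreal"
  shows "(\<Sum>\<^sub>\<infinity>x\<in>A. c * f x) = c * infsum f A"
  by (simp add: nonneg_infsum_complete sum_distrib_left[symmetric] SUP_mult_left_ennreal)

text \<open>Characterizes the coefficient families of periodic distributions, by
  \<open>fcoeff_poly_bound\<close> and \<open>distribution_exists\<close>. Existence of a multiplier
  thereby becomes a growth condition.\<close>

definition poly_bounded :: "(int ^ 'n \<Rightarrow> complex) \<Rightarrow> bool" where
  "poly_bounded c \<longleftrightarrow> (\<exists>B N. \<forall>k. norm (c k) \<le> B * bracket k ^ N)"

lemma poly_bounded_fcoeff: "u \<in> distributions \<Longrightarrow> poly_bounded (fcoeff u)"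
  unfolding poly_bounded_def by (metis fcoeff_poly_bound)

lemma poly_bounded_distribution:
  assumes "poly_bounded c"
  obtains u where "u \<in> distributions" "fcoeff u = c"
  using assms unfolding poly_bounded_def by (metis distribution_exists ext)

lemma poly_bounded_diff:
  assumes "poly_bounded c" "poly_bounded c'"
  shows "poly_bounded (\<lambda>k. c k - c' k)"
proof -
  from assms obtain B N B' N'
    where c: "\<And>k. norm (c k) \<le> B * bracket k ^ N" and c': "\<And>k. norm (c' k) \<le> B' * bracket k ^ N'"
    unfolding poly_bounded_def by blast
  have "norm (c k - c' k) \<le> (\<bar>B\<bar> + \<bar>B'\<bar>) * bracket k ^ (N + N')" for k
  proof -
    have pow: "bracket k ^ N \<le> bracket k ^ (N + N')" "bracket k ^ N' \<le> bracket k ^ (N + N')"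
      by (auto intro!: power_increasing bracket_ge_1)
    have "B * bracket k ^ N \<le> \<bar>B\<bar> * bracket k ^ (N + N')"
      "B' * bracket k ^ N' \<le> \<bar>B'\<bar> * bracket k ^ (N + N')"
      using pow by (auto intro!: mult_mono simp: less_imp_le)
    then show ?thesis
      using norm_triangle_ineq4[of "c k" "c' k"] c[of k] c'[of k] by (simp add: distrib_right)
  qed
  then show ?thesis
    unfolding poly_bounded_def by blast
qed

lemma poly_bounded_mono:
  assumes "poly_bounded c'" and le: "\<And>k. norm (c k) \<le> K * norm (c' k)"
  shows "poly_bounded c"
proof -
  from assms obtain B N where B: "\<And>k. norm (c' k) \<le> B * bracket k ^ N"
    unfolding poly_bounded_def by blast
  have "norm (c k) \<le> \<bar>K\<bar> * B * bracket k ^ N" for k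
  proof -
    have "norm (c k) \<le> \<bar>K\<bar> * norm (c' k)"
      by (rule order_trans[OF le]) (simp add: mult_right_mono)
    also have "\<dots> \<le> \<bar>K\<bar> * (B * bracket k ^ N)"
      by (rule mult_left_mono[OF B]) simp
    finally show ?thesis by (simp add: mult.assoc)
  qed
  then show ?thesis
    unfolding poly_bounded_def by blast
qed

lemma has_fmult_iff: "has_fmult \<omega> u \<longleftrightarrow> poly_bounded (\<lambda>k. complex_of_real (\<omega> k) * fcoeff u k)"
proof
  assume "has_fmult \<omega> u"
  then obtain v where "v \<in> distributions" "fcoeff v = (\<lambda>k. complex_of_real (\<omega> k) * fcoeff u k)"
    unfolding has_fmult_def by blast
  then show "poly_bounded (\<lambda>k. complex_of_real (\<omega> k) * fcoeff u k)"
    using poly_bounded_fcoeff by metis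
next
  assume "poly_bounded (\<lambda>k. complex_of_real (\<omega> k) * fcoeff u k)"
  then obtain v where "v \<in> distributions" "fcoeff v = (\<lambda>k. complex_of_real (\<omega> k) * fcoeff u k)"
    by (rule poly_bounded_distribution)
  then show "has_fmult \<omega> u"
    unfolding has_fmult_def by (intro bexI[of _ v]) simp_all
qed

text \<open>Discharges the definite description in \<open>fmult\<close>: a distribution with the
  prescribed coefficients is the only one.\<close>

lemma fmult_unique:
  assumes "v \<in> distributions" "\<And>k. fcoeff v k = complex_of_real (\<omega> k) * fcoeff u k"
  shows "fmult \<omega> u = v"
  unfolding fmult_def
  by (rule the_equality) (use assms in \<open>auto intro: distributions_eqI\<close>)

lemma fcoeff_fmult: "has_fmult \<omega> u \<Longrightarrow> fcoeff (fmult \<omega> u) k = complex_of_real (\<omega> k) * fcoeff u k"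
  unfolding has_fmult_def by (metis fmult_unique)

section \<open>The data functional and the adjoint\<close>

text \<open>The bound on \<open>W\<close> amounts to boundedness of the transform from H^r into the
  data space: mode k of the squared data norm of the transform is W_k times that of the squared H^r
  norm.\<close>

locale bounded_radon_data =
  fixes d :: nat and r C :: real
    and w :: "int ^ 'n \<Rightarrow> (rat ^ 'n) set \<Rightarrow> real"
    and g :: "(rat ^ 'n) set \<Rightarrow> (real ^ 'n \<Rightarrow> complex) \<Rightarrow> complex"
  assumes C_pos: "C > 0"
    and W_le: "\<And>k. W d w k \<le> ennreal (C\<^sup>2)"
    and g_data: "g \<in> data_space d r w"
begin

definition weight_sum :: "int ^ 'n \<Rightarrow> real" where
  "weight_sum k = (\<Sum>\<^sub>\<infinity>A\<in>Omega d k. (w k A)\<^sup>2)"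

text \<open>The share of mode k in the squared norm of the data, without the power of the bracket.
  All subspaces count here, including those not orthogonal to k.\<close>

definition data_energy :: "int ^ 'n \<Rightarrow> real" where
  "data_energy k = (\<Sum>\<^sub>\<infinity>A\<in>Gr d. (w k A)\<^sup>2 * (cmod (fcoeff (g A) k))\<^sup>2)"

text \<open>The explicit formula for the adjoint. That \<open>radon_adjoint\<close>, defined by its
  inner products, has these coefficients is \<open>fcoeff_radon_adjoint\<close>.\<close>

definition adjoint_coeff :: "int ^ 'n \<Rightarrow> complex" where
  "adjoint_coeff k = (\<Sum>\<^sub>\<infinity>A\<in>Omega d k. complex_of_real ((w k A)\<^sup>2) * fcoeff (g A) k)"

lemma weight_sq_summable: "(\<lambda>A. (w k A)\<^sup>2) summable_on Omega d k"
  using W_le[of k] by (intro summable_on_of_ennreal) (auto simp: W_def[symmetric] le_less_trans)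

lemma W_eq: "W d w k = ennreal (weight_sum k)"
  unfolding W_def weight_sum_def by (rule ennreal_infsum[OF weight_sq_summable]) simp

lemma weight_sum_nonneg: "0 \<le> weight_sum k"
  unfolding weight_sum_def by (rule infsum_nonneg) simp

lemma weight_sum_le: "weight_sum k \<le> C\<^sup>2"
  using W_le[of k] by (simp add: W_eq)

text \<open>One summand of W_k is at most the whole sum. This controls the weight at the frequencies
  orthogonal to A, which are the only ones present in the transform over A.\<close>

lemma abs_weight_le:
  assumes "A \<in> Omega d k"
  shows "\<bar>w k A\<bar> \<le> C"
proof -
  have "sum (\<lambda>A. (w k A)\<^sup>2) {A} \<le> weight_sum k"
    unfolding weight_sum_def by (rule finite_sum_le_infsum[OF weight_sq_summable]) (use assms in auto)
  then have "\<bar>w k A\<bar>\<^sup>2 \<le> C\<^sup>2"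
    using weight_sum_le[of k] by simp
  then show ?thesis
    using C_pos by (meson less_imp_le power2_le_imp_le)
qed

text \<open>If the weighted data over some A were not a distribution, \<open>data_normsq\<close>
  would contain an infinite term.\<close>

lemma has_fmult_g:
  assumes "A \<in> Gr d"
  shows "has_fmult (\<lambda>k. w k A) (g A)"
proof (rule ccontr)
  assume no: "\<not> has_fmult (\<lambda>k. w k A) (g A)"
  have "(if has_fmult (\<lambda>k. w k A) (g A) then sobolev_normsq r (fmult (\<lambda>k. w k A) (g A)) else \<infinity>)
      \<le> data_normsq d r w g"
    unfolding data_normsq_def by (rule member_le_infsum_ennreal[OF assms])
  then show False
    using g_data no by (auto simp: data_space_def top_unique)
qed

text \<open>The squared data norm with the sums exchanged, so that finiteness passes to each single
  mode.\<close>

lemma data_energy_term_sum: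
  "(\<Sum>\<^sub>\<infinity>k. \<Sum>\<^sub>\<infinity>A\<in>Gr d. ennreal (bracket k powr (2 * r) * ((w k A)\<^sup>2 * (cmod (fcoeff (g A) k))\<^sup>2))) < top"
proof -
  have "data_normsq d r w g =
      (\<Sum>\<^sub>\<infinity>A\<in>Gr d. \<Sum>\<^sub>\<infinity>k. ennreal (bracket k powr (2 * r) * ((w k A)\<^sup>2 * (cmod (fcoeff (g A) k))\<^sup>2)))"
    unfolding data_normsq_def sobolev_normsq_def
    by (intro infsum_cong) (simp add: has_fmult_g fcoeff_fmult norm_mult power_mult_distrib)
  also have "\<dots> = (\<Sum>\<^sub>\<infinity>k. \<Sum>\<^sub>\<infinity>A\<in>Gr d. ennreal (bracket k powr (2 * r) * ((w k A)\<^sup>2 * (cmod (fcoeff (g A) k))\<^sup>2)))"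
    by (rule infsum_swap_ennreal)
  finally show ?thesis
    using g_data by (simp add: data_space_def)
qed

lemma data_energy_has_sum:
  "((\<lambda>A. (w k A)\<^sup>2 * (cmod (fcoeff (g A) k))\<^sup>2) has_sum data_energy k) (Gr d)"
proof -
  have "(\<Sum>\<^sub>\<infinity>A\<in>Gr d. ennreal (bracket k powr (2 * r) * ((w k A)\<^sup>2 * (cmod (fcoeff (g A) k))\<^sup>2))) < top"
    by (rule le_less_trans[OF member_le_infsum_ennreal[OF UNIV_I] data_energy_term_sum])
  then have "(\<lambda>A. bracket k powr (2 * r) * ((w k A)\<^sup>2 * (cmod (fcoeff (g A) k))\<^sup>2)) summable_on Gr d"
    by (rule summable_on_of_ennreal) simp
  then have "(\<lambda>A. inverse (bracket k powr (2 * r)) *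
      (bracket k powr (2 * r) * ((w k A)\<^sup>2 * (cmod (fcoeff (g A) k))\<^sup>2))) summable_on Gr d"
    by (rule summable_on_cmult_right)
  moreover have "bracket k powr (2 * r) \<noteq> 0"
    by (simp add: less_imp_neq[OF bracket_pos, symmetric])
  ultimately have "(\<lambda>A. (w k A)\<^sup>2 * (cmod (fcoeff (g A) k))\<^sup>2) summable_on Gr d"
    by (simp flip: mult.assoc)
  then show ?thesis
    unfolding data_energy_def by (rule has_sum_infsum)
qed

lemma data_energy_nonneg: "0 \<le> data_energy k"
  unfolding data_energy_def by (rule infsum_nonneg) simp

lemma data_energy_summable: "(\<lambda>k. bracket k powr (2 * r) * data_energy k) summable_on UNIV"
proof (rule summable_on_of_ennreal)
  have "(\<Sum>\<^sub>\<infinity>A\<in>Gr d. ennreal (bracket k powr (2 * r) * ((w k A)\<^sup>2 * (cmod (fcoeff (g A) k))\<^sup>2))) =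
      ennreal (bracket k powr (2 * r) * data_energy k)" for k
    using has_sum_cmult_right[OF data_energy_has_sum, of "bracket k powr (2 * r)" k]
    by (subst ennreal_infsum) (auto simp: has_sum_iff)
  then show "(\<Sum>\<^sub>\<infinity>k. ennreal (bracket k powr (2 * r) * data_energy k)) < top"
    using data_energy_term_sum by simp
qed (simp add: data_energy_nonneg)

lemma weight_sum_has_sum:
  "((\<lambda>A. if perp k A then (w k A)\<^sup>2 else 0) has_sum weight_sum k) (Gr d)"
proof -
  have "((\<lambda>A. (w k A)\<^sup>2) has_sum weight_sum k) (Omega d k)"
    unfolding weight_sum_def by (rule has_sum_infsum[OF weight_sq_summable])
  then show ?thesis
    by (subst has_sum_cong_neutral[where T = "Omega d k" and g = "\<lambda>A. (w k A)\<^sup>2"]) (auto simp: Omega_def)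
qed

text \<open>Absolute convergence comes from w^2 |g| \<le> w^2 + w^2 |g|^2, where both parts are
  summable over \<open>Omega d k\<close>. Extension by zero to \<open>Gr d\<close> allows termwise
  addition to the data energy.\<close>

lemma adjoint_coeff_has_sum:
  "((\<lambda>A. if perp k A then complex_of_real ((w k A)\<^sup>2) * fcoeff (g A) k else 0) has_sum adjoint_coeff k) (Gr d)"
proof -
  have "(\<lambda>A. (w k A)\<^sup>2 * (cmod (fcoeff (g A) k))\<^sup>2) summable_on Omega d k"
    by (rule summable_on_subset_banach[OF has_sum_imp_summable[OF data_energy_has_sum]])
      (auto simp: Omega_def)
  then have "(\<lambda>A. (w k A)\<^sup>2 + (w k A)\<^sup>2 * (cmod (fcoeff (g A) k))\<^sup>2) summable_on Omega d k"
    by (rule summable_on_add[OF weight_sq_summable])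
  then have "(\<lambda>A. norm (complex_of_real ((w k A)\<^sup>2) * fcoeff (g A) k)) summable_on Omega d k"
  proof (rule summable_on_comparison_test)
    fix A
    \<comment> \<open>From (x - 1/2)^2 \<ge> 0, which even gives x \<le> x^2 + 1/4.\<close>
    have "x \<le> 1 + x\<^sup>2" for x :: real
      using zero_le_power2[of "x - 1 / 2"] unfolding power2_eq_square
      by (simp only: left_diff_distrib right_diff_distrib)
    from mult_left_mono[OF this, of "(w k A)\<^sup>2"]
    show "norm (complex_of_real ((w k A)\<^sup>2) * fcoeff (g A) k) \<le> (w k A)\<^sup>2 + (w k A)\<^sup>2 * (cmod (fcoeff (g A) k))\<^sup>2"
      by (simp add: norm_mult norm_power distrib_left)
  qed simp
  then have "((\<lambda>A. complex_of_real ((w k A)\<^sup>2) * fcoeff (g A) k) has_sum adjoint_coeff k) (Omega d k)"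
    unfolding adjoint_coeff_def by (rule has_sum_infsum[OF abs_summable_summable])
  then show ?thesis
    by (subst has_sum_cong_neutral[where T = "Omega d k" and
          g = "\<lambda>A. complex_of_real ((w k A)\<^sup>2) * fcoeff (g A) k"]) (auto simp: Omega_def)
qed

text \<open>The squared data misfit in mode k when f has coefficient z there, again without the
  power of the bracket, already expanded as a quadratic function of z.\<close>

definition residual :: "int ^ 'n \<Rightarrow> complex \<Rightarrow> real" where
  "residual k z = weight_sum k * (cmod z)\<^sup>2 - 2 * Re (z * cnj (adjoint_coeff k)) + data_energy k"

lemma residual_has_sum:
  "((\<lambda>A. (w k A)\<^sup>2 * (cmod ((if perp k A then z else 0) - fcoeff (g A) k))\<^sup>2) has_sum residual k z) (Gr d)"
proof -
  have "((\<lambda>A. Re (z * cnj (if perp k A then complex_of_real ((w k A)\<^sup>2) * fcoeff (g A) k else 0))) has_sum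
      Re (z * cnj (adjoint_coeff k))) (Gr d)"
    by (intro has_sum_Re has_sum_cmult_right) (simp only: has_sum_cnj_iff adjoint_coeff_has_sum)
  then have "((\<lambda>A. (if perp k A then (w k A)\<^sup>2 else 0) * (cmod z)\<^sup>2 +
      (- 2) * Re (z * cnj (if perp k A then complex_of_real ((w k A)\<^sup>2) * fcoeff (g A) k else 0)) +
      (w k A)\<^sup>2 * (cmod (fcoeff (g A) k))\<^sup>2) has_sum
      weight_sum k * (cmod z)\<^sup>2 + (- 2) * Re (z * cnj (adjoint_coeff k)) + data_energy k) (Gr d)"
    by (intro has_sum_add has_sum_cmult_left has_sum_cmult_right weight_sum_has_sum data_energy_has_sum)
  moreover have "(if perp k A then (w k A)\<^sup>2 else 0) * (cmod z)\<^sup>2 +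
      (- 2) * Re (z * cnj (if perp k A then complex_of_real ((w k A)\<^sup>2) * fcoeff (g A) k else 0)) +
      (w k A)\<^sup>2 * (cmod (fcoeff (g A) k))\<^sup>2 =
      (w k A)\<^sup>2 * (cmod ((if perp k A then z else 0) - fcoeff (g A) k))\<^sup>2" for A
    unfolding cmod_power2 by (auto simp: power2_eq_square algebra_simps)
  ultimately show ?thesis
    unfolding residual_def by (simp only: minus_mult_left[symmetric] diff_conv_add_uminus)
qed

lemma residual_nonneg: "0 \<le> residual k z"
  by (rule has_sum_nonneg[OF residual_has_sum]) simp

lemma cmod_adjoint_coeff_le: "(cmod (adjoint_coeff k))\<^sup>2 \<le> C\<^sup>2 * data_energy k"
proof -
  \<comment> \<open>The residual is nonnegative, in particular at \<open>adjoint_coeff k / C\<^sup>2\<close>.\<close>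
  let ?h = "adjoint_coeff k" and ?c = "complex_of_real (1 / C\<^sup>2)"
  have "0 \<le> residual k (?c * ?h)"
    by (rule residual_nonneg)
  also have "residual k (?c * ?h) =
      weight_sum k * (cmod ?h)\<^sup>2 / C ^ 4 - 2 * (cmod ?h)\<^sup>2 / C\<^sup>2 + data_energy k"
  proof -
    have "?c * ?h * cnj ?h = complex_of_real ((cmod ?h)\<^sup>2 / C\<^sup>2)"
      by (simp add: mult.assoc complex_norm_square[symmetric])
    then have "2 * Re (?c * ?h * cnj ?h) = 2 * (cmod ?h)\<^sup>2 / C\<^sup>2"
      by (simp only: Re_complex_of_real)
    moreover have "(cmod (?c * ?h))\<^sup>2 = (cmod ?h)\<^sup>2 / C ^ 4"
      by (simp add: norm_mult norm_divide norm_power power_mult_distrib power_divide)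
    ultimately show ?thesis
      unfolding residual_def by (simp only: times_divide_eq_right)
  qed
  also have "weight_sum k * (cmod ?h)\<^sup>2 / C ^ 4 \<le> C\<^sup>2 * (cmod ?h)\<^sup>2 / C ^ 4"
    using weight_sum_le[of k] C_pos by (intro divide_right_mono mult_right_mono) auto
  also have "C\<^sup>2 * (cmod ?h)\<^sup>2 / C ^ 4 = (cmod ?h)\<^sup>2 / C\<^sup>2"
    using C_pos by (simp add: power4_eq_xxxx power2_eq_square)
  finally have "(cmod ?h)\<^sup>2 / C\<^sup>2 \<le> data_energy k"
    by simp
  then show ?thesis
    using C_pos by (simp add: field_simps)
qed

lemma adjoint_coeff_summable:
  "(\<lambda>k. bracket k powr (2 * r) * (cmod (adjoint_coeff k))\<^sup>2) summable_on UNIV"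
proof (rule summable_on_comparison_test[OF summable_on_cmult_right[OF data_energy_summable, of "C\<^sup>2"]])
  show "bracket k powr (2 * r) * (cmod (adjoint_coeff k))\<^sup>2 \<le> C\<^sup>2 * (bracket k powr (2 * r) * data_energy k)" for k
    using mult_left_mono[OF cmod_adjoint_coeff_le, of "bracket k powr (2 * r)" k]
    by (simp add: mult_ac)
qed simp

text \<open>Each term of the convergent H^r series is at most its sum \<open>K\<close>, so the
  coefficients grow no faster than the power -r of the bracket. \<open>N\<close> rounds |r| up to
  serve both signs of r.\<close>

lemma poly_bounded_adjoint_coeff: "poly_bounded adjoint_coeff"
proof -
  define K where "K = (\<Sum>\<^sub>\<infinity>k. bracket k powr (2 * r) * (cmod (adjoint_coeff k))\<^sup>2)"
  define N where "N = nat \<lceil>\<bar>r\<bar>\<rceil>"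
  have "norm (adjoint_coeff k) \<le> sqrt K * bracket k ^ N" for k
  proof -
    have "sum (\<lambda>k. bracket k powr (2 * r) * (cmod (adjoint_coeff k))\<^sup>2) {k} \<le> K"
      unfolding K_def by (rule finite_sum_le_infsum[OF adjoint_coeff_summable]) auto
    then have "(bracket k powr r * cmod (adjoint_coeff k))\<^sup>2 \<le> K"
      by (simp add: power_mult_distrib power2_eq_square[of "_ powr _"] powr_add[symmetric])
    then have "bracket k powr r * cmod (adjoint_coeff k) \<le> sqrt K"
      by (rule real_le_rsqrt)
    then have "bracket k powr (- r) * (bracket k powr r * cmod (adjoint_coeff k)) \<le> bracket k powr (- r) * sqrt K"
      by (rule mult_left_mono) simp
    moreover have "bracket k powr (- r) * (bracket k powr r * cmod (adjoint_coeff k)) = cmod (adjoint_coeff k)"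
      by (simp add: powr_minus less_imp_neq[OF bracket_pos, symmetric])
    moreover have "bracket k powr (- r) * sqrt K \<le> bracket k ^ N * sqrt K"
    proof (rule mult_right_mono)
      have "bracket k powr (- r) \<le> bracket k powr (real N)"
        by (rule powr_mono) (auto simp: N_def bracket_ge_1, linarith)
      then show "bracket k powr (- r) \<le> bracket k ^ N"
        by (simp add: powr_realpow)
      show "0 \<le> sqrt K"
        unfolding K_def by (intro real_sqrt_ge_zero infsum_nonneg) simp
    qed
    ultimately show ?thesis by (simp add: mult.commute)
  qed
  then show ?thesis
    unfolding poly_bounded_def by blast
qed

lemma poly_bounded_weight_radon:
  assumes f: "f \<in> distributions" and A: "A \<in> Gr d"
  shows "poly_bounded (\<lambda>k. complex_of_real (w k A) * fcoeff (radon f A) k)"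
proof (rule poly_bounded_mono[OF poly_bounded_fcoeff[OF f]])
  show "norm (complex_of_real (w k A) * fcoeff (radon f A) k) \<le> C * norm (fcoeff f k)" for k
    using abs_weight_le[of A k] A C_pos
    by (auto simp: fcoeff_radon[OF f A] norm_mult Omega_def intro!: mult_right_mono)
qed

text \<open>Holds for every distribution f, with both sides possibly infinite. The multiplier must
  first be shown to exist, since otherwise \<open>data_normsq\<close> would take its default value
  \<infinity>.\<close>

lemma data_normsq_residual:
  assumes f: "f \<in> distributions"
  shows "data_normsq d r w (\<lambda>A. minus_distr (radon f A) (g A)) =
    (\<Sum>\<^sub>\<infinity>k. ennreal (bracket k powr (2 * r) * residual k (fcoeff f k)))"
proof -
  let ?t = "\<lambda>A k. bracket k powr (2 * r) *
    ((w k A)\<^sup>2 * (cmod ((if perp k A then fcoeff f k else 0) - fcoeff (g A) k))\<^sup>2)"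
  have mult: "has_fmult (\<lambda>k. w k A) (minus_distr (radon f A) (g A))" if A: "A \<in> Gr d" for A
    using poly_bounded_diff[OF poly_bounded_weight_radon[OF f A]] has_fmult_g[OF A]
    by (simp add: has_fmult_iff fcoeff_minus_distr right_diff_distrib)
  have "data_normsq d r w (\<lambda>A. minus_distr (radon f A) (g A)) = (\<Sum>\<^sub>\<infinity>A\<in>Gr d. \<Sum>\<^sub>\<infinity>k. ennreal (?t A k))"
    unfolding data_normsq_def sobolev_normsq_def
    by (intro infsum_cong)
      (simp add: mult fcoeff_fmult fcoeff_minus_distr fcoeff_radon[OF f] norm_mult power_mult_distrib)
  also have "\<dots> = (\<Sum>\<^sub>\<infinity>k. \<Sum>\<^sub>\<infinity>A\<in>Gr d. ennreal (?t A k))"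
    by (rule infsum_swap_ennreal)
  also have "\<dots> = (\<Sum>\<^sub>\<infinity>k. ennreal (bracket k powr (2 * r) * residual k (fcoeff f k)))"
  proof (rule infsum_cong)
    fix k
    have "((\<lambda>A. ?t A k) has_sum bracket k powr (2 * r) * residual k (fcoeff f k)) (Gr d)"
      by (rule has_sum_cmult_right[OF residual_has_sum])
    then show "(\<Sum>\<^sub>\<infinity>A\<in>Gr d. ennreal (?t A k)) = ennreal (bracket k powr (2 * r) * residual k (fcoeff f k))"
      by (subst ennreal_infsum) (auto simp: has_sum_iff)
  qed
  finally show ?thesis .
qed

section \<open>Inner products and the Hilbert space adjoint\<close>

lemma sobolev_summable:
  "f \<in> sobolev t \<Longrightarrow> (\<lambda>k. bracket k powr (2 * t) * (cmod (fcoeff f k))\<^sup>2) summable_on UNIV"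
  by (rule summable_on_of_ennreal) (auto simp: sobolev_def sobolev_normsq_def)

lemma sobolevI:
  assumes "f \<in> distributions" "(\<lambda>k. bracket k powr (2 * t) * (cmod (fcoeff f k))\<^sup>2) summable_on UNIV"
  shows "f \<in> sobolev t"
  using ennreal_infsum[OF assms(2)] assms(1) by (simp add: sobolev_def sobolev_normsq_def)

text \<open>The terms are complex, so exchanging the sums requires absolute convergence on the
  product index set. The majorant \<open>M\<close> comes from |ab| \<le> a^2 + b^2: its first part
  is controlled by C^2 times the H^r norm of f, its second by the data norm.\<close>

lemma data_inner_radon:
  assumes f: "f \<in> sobolev r"
  shows "data_inner d r w (radon f) g =
    (\<Sum>\<^sub>\<infinity>k. complex_of_real (bracket k powr (2 * r)) * fcoeff f k * cnj (adjoint_coeff k))"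
proof -
  have fd: "f \<in> distributions" using f by (simp add: sobolev_def)
  define T where "T A k = complex_of_real (bracket k powr (2 * r)) * fcoeff f k *
      cnj (if perp k A then complex_of_real ((w k A)\<^sup>2) * fcoeff (g A) k else 0)" for A k
  define M where "M = (\<lambda>(k, A). bracket k powr (2 * r) *
      ((if perp k A then (w k A)\<^sup>2 else 0) * (cmod (fcoeff f k))\<^sup>2 +
        (w k A)\<^sup>2 * (cmod (fcoeff (g A) k))\<^sup>2))"
  have "M summable_on UNIV \<times> Gr d"
  proof (rule summable_on_SigmaI)
    show "((\<lambda>A. M (k, A)) has_sum
        bracket k powr (2 * r) * (weight_sum k * (cmod (fcoeff f k))\<^sup>2 + data_energy k)) (Gr d)" for k
      unfolding M_def case_prod_conv
      by (intro has_sum_cmult_right has_sum_cmult_left has_sum_add weight_sum_has_sum data_energy_has_sum)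
    have "(\<lambda>k. bracket k powr (2 * r) * (weight_sum k * (cmod (fcoeff f k))\<^sup>2)) summable_on UNIV"
    proof (rule summable_on_comparison_test[OF summable_on_cmult_right[OF sobolev_summable[OF f], of "C\<^sup>2"]])
      show "bracket k powr (2 * r) * (weight_sum k * (cmod (fcoeff f k))\<^sup>2)
          \<le> C\<^sup>2 * (bracket k powr (2 * r) * (cmod (fcoeff f k))\<^sup>2)" for k
        using mult_right_mono[OF weight_sum_le, of "bracket k powr (2 * r) * (cmod (fcoeff f k))\<^sup>2" k]
        by (simp add: mult_ac)
    qed (simp add: weight_sum_nonneg)
    from summable_on_add[OF this data_energy_summable]
    show "(\<lambda>k. bracket k powr (2 * r) * (weight_sum k * (cmod (fcoeff f k))\<^sup>2 + data_energy k)) summable_on UNIV"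
      by (simp add: distrib_left)
  qed (auto simp: M_def)
  then have "(\<lambda>x. norm ((\<lambda>(k, A). T A k) x)) summable_on UNIV \<times> Gr d"
  proof (rule summable_on_comparison_test)
    fix x :: "(int ^ 'n) \<times> (rat ^ 'n) set"
    obtain k A where x: "x = (k, A)" by force
    have "a * b \<le> a\<^sup>2 + b\<^sup>2" for a b :: real
      using sum_squares_bound[of a b] sum_squares_ge_zero[of a b] unfolding power2_eq_square by linarith
    from mult_left_mono[OF this[of "cmod (fcoeff f k)" "cmod (fcoeff (g A) k)"], of "bracket k powr (2 * r) * (w k A)\<^sup>2"]
    show "norm ((\<lambda>(k, A). T A k) x) \<le> M x"
      by (auto simp: x T_def M_def norm_mult norm_power algebra_simps)
  qed simp
  then have summ: "(\<lambda>(k, A). T A k) summable_on UNIV \<times> Gr d"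
    by (rule abs_summable_summable)
  have "data_inner d r w (radon f) g = (\<Sum>\<^sub>\<infinity>A\<in>Gr d. \<Sum>\<^sub>\<infinity>k. T A k)"
    unfolding data_inner_def sobolev_inner_def
  proof (intro infsum_cong)
    fix A :: "(rat ^ 'n) set" and k assume A: "A \<in> Gr d"
    have "has_fmult (\<lambda>k. w k A) (radon f A)"
      by (simp add: has_fmult_iff poly_bounded_weight_radon[OF fd A])
    then show "complex_of_real (bracket k powr (2 * r)) * fcoeff (fmult (\<lambda>k. w k A) (radon f A)) k *
        cnj (fcoeff (fmult (\<lambda>k. w k A) (g A)) k) = T A k"
      by (simp add: fcoeff_fmult has_fmult_g[OF A] fcoeff_radon[OF fd A] T_def power2_eq_square)
  qed
  also have "\<dots> = (\<Sum>\<^sub>\<infinity>k. \<Sum>\<^sub>\<infinity>A\<in>Gr d. T A k)"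
    by (rule infsum_swap_banach[symmetric]) (use summ in simp)
  also have "\<dots> = (\<Sum>\<^sub>\<infinity>k. complex_of_real (bracket k powr (2 * r)) * fcoeff f k * cnj (adjoint_coeff k))"
  proof (rule infsum_cong)
    show "(\<Sum>\<^sub>\<infinity>A\<in>Gr d. T A k) = complex_of_real (bracket k powr (2 * r)) * fcoeff f k * cnj (adjoint_coeff k)" for k
      unfolding T_def
      by (intro infsumI has_sum_cmult_right) (simp only: has_sum_cnj_iff adjoint_coeff_has_sum)
  qed
  finally show ?thesis .
qed

text \<open>The family \<open>adjoint_coeff\<close> defines an element of H^r with the required
  inner products. For uniqueness, testing with the distribution whose only nonzero coefficient sits
  at k recovers the coefficient of any candidate at k.\<close>

lemma fcoeff_radon_adjoint: "fcoeff (radon_adjoint d r w g) k = adjoint_coeff k"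
proof -
  obtain h where h: "h \<in> distributions" "fcoeff h = adjoint_coeff"
    using poly_bounded_distribution[OF poly_bounded_adjoint_coeff] by blast
  have hs: "h \<in> sobolev r"
    by (rule sobolevI) (simp_all add: h adjoint_coeff_summable)
  have "radon_adjoint d r w g = h"
    unfolding radon_adjoint_def
  proof (rule the_equality)
    show "h \<in> sobolev r \<and> (\<forall>f\<in>sobolev r. data_inner d r w (radon f) g = sobolev_inner r f h)"
      by (simp add: hs data_inner_radon sobolev_inner_def h)
  next
    fix h' assume h': "h' \<in> sobolev r \<and> (\<forall>f\<in>sobolev r. data_inner d r w (radon f) g = sobolev_inner r f h')"
    show "h' = h"
    proof (rule distributions_eqI)
      fix k :: "int ^ 'n"
      have "poly_bounded (\<lambda>j. if j = k then 1 else 0)"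
        unfolding poly_bounded_def by (intro exI[of _ 1] exI[of _ 0]) auto
      then obtain f where f: "f \<in> distributions" "fcoeff f = (\<lambda>j. if j = k then 1 else 0)"
        by (rule poly_bounded_distribution)
      have inner: "(\<Sum>\<^sub>\<infinity>j. complex_of_real (bracket j powr (2 * r)) * fcoeff f j * cnj (c j)) =
          complex_of_real (bracket k powr (2 * r)) * cnj (c k)" for c
      proof -
        have "(\<Sum>\<^sub>\<infinity>j. complex_of_real (bracket j powr (2 * r)) * fcoeff f j * cnj (c j)) =
            (\<Sum>\<^sub>\<infinity>j\<in>{k}. complex_of_real (bracket j powr (2 * r)) * fcoeff f j * cnj (c j))"
          by (rule infsum_cong_neutral) (auto simp: f)
        then show ?thesis by (simp add: f)
      qed
      have "f \<in> sobolev r"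
      proof (rule sobolevI[OF f(1)])
        show "(\<lambda>j. bracket j powr (2 * r) * (cmod (fcoeff f j))\<^sup>2) summable_on UNIV"
          by (rule finite_nonzero_values_imp_summable_on) (simp add: f)
      qed
      then have "sobolev_inner r f h' = data_inner d r w (radon f) g"
        using h' by simp
      also have "\<dots> = complex_of_real (bracket k powr (2 * r)) * cnj (adjoint_coeff k)"
        unfolding data_inner_radon[OF \<open>f \<in> sobolev r\<close>] by (rule inner)
      finally have "complex_of_real (bracket k powr (2 * r)) * cnj (fcoeff h' k) =
          complex_of_real (bracket k powr (2 * r)) * cnj (adjoint_coeff k)"
        unfolding sobolev_inner_def inner .
      then show "fcoeff h' k = fcoeff h k"
        by (simp add: h less_imp_neq[OF bracket_pos, symmetric])
    qed (use h h' in \<open>auto simp: sobolev_def\<close>)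
  qed
  then show ?thesis
    by (simp add: h)
qed

end

section \<open>The Tikhonov functional\<close>

locale tikhonov_problem = bounded_radon_data d r C w g
  for d :: nat and r C :: real
    and w :: "int ^ 'n \<Rightarrow> (rat ^ 'n) set \<Rightarrow> real"
    and g :: "(rat ^ 'n) set \<Rightarrow> (real ^ 'n \<Rightarrow> complex) \<Rightarrow> complex" +
  fixes s \<alpha> :: real
  assumes \<alpha>_pos: "\<alpha> > 0" and s_ge_r: "s \<ge> r"
begin

text \<open>The reciprocal of the symbol of P. Up to the power 2r of the bracket it is also the
  leading coefficient of the quadratic function to be minimized in mode k.\<close>

definition modulus :: "int ^ 'n \<Rightarrow> real" where
  "modulus k = weight_sum k + \<alpha> * bracket k powr (2 * (s - r))"

definition minimizer :: "(real ^ 'n \<Rightarrow> complex) \<Rightarrow> complex" where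
  "minimizer = P_mult d w (s - r) \<alpha> (radon_adjoint d r w g)"

lemma modulus_ge: "\<alpha> * bracket k powr (2 * (s - r)) \<le> modulus k"
  by (simp add: modulus_def weight_sum_nonneg)

text \<open>For s \<ge> r the penalty contributes at least \<alpha> in every mode. The symbol of P
  is therefore at most 1/\<alpha>, and applying P preserves polynomial boundedness.\<close>

lemma modulus_ge_\<alpha>: "\<alpha> \<le> modulus k"
proof -
  have "1 \<le> bracket k powr (2 * (s - r))"
    using s_ge_r by (intro ge_one_powr_ge_zero bracket_ge_1) auto
  then have "\<alpha> * 1 \<le> \<alpha> * bracket k powr (2 * (s - r))"
    using \<alpha>_pos by (intro mult_left_mono) auto
  then show ?thesis
    using modulus_ge[of k] by simp
qed

lemma modulus_pos: "0 < modulus k"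
  using modulus_ge_\<alpha>[of k] \<alpha>_pos by linarith

lemma shows minimizer_distr: "minimizer \<in> distributions"
    and fcoeff_minimizer: "fcoeff minimizer k = adjoint_coeff k / complex_of_real (modulus k)"
proof -
  have "poly_bounded (\<lambda>k. adjoint_coeff k / complex_of_real (modulus k))"
  proof (rule poly_bounded_mono[OF poly_bounded_adjoint_coeff])
    fix k
    show "norm (adjoint_coeff k / complex_of_real (modulus k)) \<le> 1 / \<alpha> * norm (adjoint_coeff k)"
      using modulus_ge_\<alpha>[of k] \<alpha>_pos by (simp add: norm_divide frac_le)
  qed
  then obtain u where u: "u \<in> distributions" "fcoeff u = (\<lambda>k. adjoint_coeff k / complex_of_real (modulus k))"
    by (rule poly_bounded_distribution)
  have "minimizer = u"
    unfolding minimizer_def P_mult_def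
    by (rule fmult_unique[OF u(1)])
      (simp add: u fcoeff_radon_adjoint W_eq weight_sum_nonneg modulus_def)
  then show "minimizer \<in> distributions" "fcoeff minimizer k = adjoint_coeff k / complex_of_real (modulus k)"
    by (simp_all add: u)
qed

text \<open>Division by a modulus of at least \<alpha> times the power 2(s - r) of the bracket gains
  2(s - r) derivatives over the adjoint data, which lie in H^r.\<close>

lemma minimizer_sobolev: "minimizer \<in> sobolev (2 * s - r)"
proof (rule sobolevI[OF minimizer_distr])
  show "(\<lambda>k. bracket k powr (2 * (2 * s - r)) * (cmod (fcoeff minimizer k))\<^sup>2) summable_on UNIV"
  proof (rule summable_on_comparison_test[OF summable_on_cmult_right[OF adjoint_coeff_summable, of "1 / \<alpha>\<^sup>2"]])
    fix k
    let ?b = "bracket k" and ?h = "cmod (adjoint_coeff k)"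
    have b: "?b powr (2 * (2 * s - r)) = ?b powr (2 * r) * (?b powr (2 * (s - r)))\<^sup>2"
      by (simp add: power2_eq_square powr_add[symmetric] algebra_simps)
    have "?b powr (2 * (s - r)) * (?h / modulus k) \<le> ?h / \<alpha>"
      using mult_right_mono[OF modulus_ge[of k], of ?h] modulus_pos[of k] \<alpha>_pos
      by (simp add: field_simps)
    then have "(?b powr (2 * (s - r)) * (?h / modulus k))\<^sup>2 \<le> (?h / \<alpha>)\<^sup>2"
      using modulus_pos[of k] by (intro power_mono) auto
    then have "?b powr (2 * r) * (?b powr (2 * (s - r)) * (?h / modulus k))\<^sup>2 \<le> ?b powr (2 * r) * (?h / \<alpha>)\<^sup>2"
      by (rule mult_left_mono) simp
    then show "?b powr (2 * (2 * s - r)) * (cmod (fcoeff minimizer k))\<^sup>2 \<le> 1 / \<alpha>\<^sup>2 * (?b powr (2 * r) * ?h\<^sup>2)"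
      unfolding b using modulus_pos[of k]
      by (simp add: fcoeff_minimizer norm_divide power_mult_distrib power_divide mult.assoc)
  qed simp
qed

definition term_value :: "int ^ 'n \<Rightarrow> complex \<Rightarrow> real" where
  "term_value k z = bracket k powr (2 * r) * residual k z + \<alpha> * (bracket k powr (2 * s) * (cmod z)\<^sup>2)"

lemma term_value_nonneg: "0 \<le> term_value k z"
  using \<alpha>_pos by (simp add: term_value_def residual_nonneg)

lemma tikhonov_eq:
  assumes f: "f \<in> distributions"
  shows "tikhonov d r s w \<alpha> g f = (\<Sum>\<^sub>\<infinity>k. ennreal (term_value k (fcoeff f k)))"
  unfolding tikhonov_def data_normsq_residual[OF f] sobolev_normsq_def infsum_cmult_ennreal[symmetric]
  by (subst infsum_add[OF summable_ennreal summable_ennreal, symmetric])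
    (use \<alpha>_pos in \<open>simp add: term_value_def residual_nonneg flip: ennreal_mult\<close>)

lemma term_value_complete_square:
  "term_value k z = term_value k (fcoeff minimizer k) +
     bracket k powr (2 * r) * modulus k * (cmod (z - fcoeff minimizer k))\<^sup>2"
proof -
  define m where "m = modulus k"
  define a where "a = adjoint_coeff k / complex_of_real m"
  have m: "m > 0" by (simp add: m_def modulus_pos)
  have h: "adjoint_coeff k = complex_of_real m * a"
    using m by (simp add: a_def)
  \<comment> \<open>Splitting off the common factor of order 2r merges the penalty with W_k into the
    single leading coefficient \<open>m\<close>.\<close>
  have "bracket k powr (2 * s) = bracket k powr (2 * r) * bracket k powr (2 * (s - r))"
    by (simp add: powr_add[symmetric] algebra_simps)
  then have val: "term_value k y = bracket k powr (2 * r) *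
      (m * (cmod y)\<^sup>2 - 2 * m * Re (y * cnj a) + data_energy k)" for y
    by (simp add: term_value_def residual_def m_def modulus_def h[unfolded m_def modulus_def] algebra_simps)
  have square: "m * (cmod z)\<^sup>2 - 2 * m * Re (z * cnj a) =
      m * (cmod a)\<^sup>2 - 2 * m * Re (a * cnj a) + m * (cmod (z - a))\<^sup>2"
    unfolding cmod_power2 by (simp add: power2_eq_square algebra_simps)
  show ?thesis
    unfolding fcoeff_minimizer m_def[symmetric] a_def[symmetric] val square
    by (simp only: distrib_left right_diff_distrib mult.assoc add_ac)
qed

text \<open>The excess over the minimum is stated as a summand instead of a difference, so that the
  identity also covers an f with infinite functional.\<close>

lemma tikhonov_minimizer:
  assumes f: "f \<in> distributions"
  shows "tikhonov d r s w \<alpha> g f = tikhonov d r s w \<alpha> g minimizer +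
    (\<Sum>\<^sub>\<infinity>k. ennreal (bracket k powr (2 * r) * modulus k * (cmod (fcoeff f k - fcoeff minimizer k))\<^sup>2))"
  unfolding tikhonov_eq[OF f] tikhonov_eq[OF minimizer_distr]
proof (subst infsum_add[OF summable_ennreal summable_ennreal, symmetric], rule infsum_cong)
  show "ennreal (term_value k (fcoeff f k)) = ennreal (term_value k (fcoeff minimizer k)) +
      ennreal (bracket k powr (2 * r) * modulus k * (cmod (fcoeff f k - fcoeff minimizer k))\<^sup>2)" for k
    using modulus_pos[of k]
    by (subst term_value_complete_square) (simp add: ennreal_plus term_value_nonneg)
qed

text \<open>In each mode the vertex value is at most the value at z = 0, and the values at 0 add up
  to the squared norm of g.\<close>

lemma tikhonov_minimizer_finite: "tikhonov d r s w \<alpha> g minimizer < top"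
proof -
  have "tikhonov d r s w \<alpha> g minimizer \<le> (\<Sum>\<^sub>\<infinity>k. ennreal (bracket k powr (2 * r) * data_energy k))"
    unfolding tikhonov_eq[OF minimizer_distr]
  proof (rule infsum_mono)
    fix k
    have "term_value k (fcoeff minimizer k) \<le> term_value k 0"
      using term_value_complete_square[of k 0] modulus_pos[of k] by simp
    then show "ennreal (term_value k (fcoeff minimizer k)) \<le> ennreal (bracket k powr (2 * r) * data_energy k)"
      by (intro ennreal_leI) (simp add: term_value_def residual_def)
  qed (rule summable_ennreal)+
  also have "\<dots> < top"
    by (subst ennreal_infsum[OF data_energy_summable]) (simp_all add: data_energy_nonneg)
  finally show ?thesis .
qed

text \<open>Distinct distributions differ in some coefficient, and this single mode makes the excess
  positive because the modulus is.\<close>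

lemma tikhonov_less:
  assumes f: "f \<in> distributions" and "f \<noteq> minimizer"
  shows "tikhonov d r s w \<alpha> g minimizer < tikhonov d r s w \<alpha> g f"
proof -
  obtain k where k: "fcoeff f k \<noteq> fcoeff minimizer k"
    using distributions_eqI[OF f minimizer_distr] assms(2) by blast
  have "0 < ennreal (bracket k powr (2 * r) * modulus k * (cmod (fcoeff f k - fcoeff minimizer k))\<^sup>2)"
    using k modulus_pos[of k] by (simp add: less_imp_neq[OF bracket_pos, symmetric])
  also have "\<dots> \<le> (\<Sum>\<^sub>\<infinity>k. ennreal (bracket k powr (2 * r) * modulus k * (cmod (fcoeff f k - fcoeff minimizer k))\<^sup>2))"
    by (rule member_le_infsum_ennreal) simp
  finally have pos: "0 < (\<Sum>\<^sub>\<infinity>k. ennreal (bracket k powr (2 * r) * modulus k * (cmod (fcoeff f k - fcoeff minimizer k))\<^sup>2))" .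
  show ?thesis
    unfolding tikhonov_minimizer[OF f]
    using ennreal_add_left_cancel_less[of "tikhonov d r s w \<alpha> g minimizer" 0] pos tikhonov_minimizer_finite
    by (simp add: less_top)
qed

lemma is_arg_min_tikhonov:
  "is_arg_min (tikhonov d r s w \<alpha> g) (\<lambda>f. f \<in> distributions) f \<longleftrightarrow> f = minimizer"
proof
  assume "is_arg_min (tikhonov d r s w \<alpha> g) (\<lambda>f. f \<in> distributions) f"
  then show "f = minimizer"
    using tikhonov_less minimizer_distr unfolding is_arg_min_def by blast
next
  assume "f = minimizer"
  then show "is_arg_min (tikhonov d r s w \<alpha> g) (\<lambda>f. f \<in> distributions) f"
    using tikhonov_less minimizer_distr unfolding is_arg_min_def by (metis less_asym less_irrefl)
qed

end

theorem theorem1p4: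
  fixes d :: nat
    and w :: "int ^ 'n \<Rightarrow> (rat ^ 'n) set \<Rightarrow> real"
    and c C \<alpha> r s :: real
    and g :: "(rat ^ 'n) set \<Rightarrow> (real ^ 'n \<Rightarrow> complex) \<Rightarrow> complex"
  assumes "CARD('n) \<ge> 2"
    and "1 \<le> d" and "d \<le> CARD('n) - 1"
    and "weight d w"
    and "c > 0" and "C > 0"
    and "\<And>k. ennreal (c\<^sup>2) \<le> W d w k \<and> W d w k \<le> ennreal (C\<^sup>2)"
    and "\<alpha> > 0"
    and "s \<ge> r"
    and "g \<in> data_space d r w"
  shows "(\<forall>f. is_arg_min (tikhonov d r s w \<alpha> g) (\<lambda>f. f \<in> distributions) f \<longleftrightarrow>
              f = P_mult d w (s - r) \<alpha> (radon_adjoint d r w g)) \<and>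
         P_mult d w (s - r) \<alpha> (radon_adjoint d r w g) \<in> sobolev (2 * s - r)"
proof -
  interpret tikhonov_problem d r C w g s \<alpha>
    by unfold_locales (use assms in auto)
  show ?thesis
    using is_arg_min_tikhonov minimizer_sobolev unfolding minimizer_def by blast
qed

end
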